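(* Let $d,k$ be positive integers. The following are equivalent: (1) There exists an infinite sequence $X=n_0n_1n_2\cdots$ of positive integers (with no computability restriction) such that $X\in \mathrm{ENSH}^d_k$, i.e. $\mathrm{ENSH}^d_k(n_0\cdots n_{r-1})$ holds for every $r>0$. (2) There exists a $\mathsf{VWI}(d,k)$-instance $c:d^{<\omega}\to k$ that does not admit a $c$-computable $\mathsf{VWI}(d,k)$-solution.
   Context: Identify $d$ with $\{0,\dots,d-1\}$ and $k$ with $\{0,\dots,k-1\}$; $d^n$ is the set of words of length $n$ over $d$, and $d^{<\omega}$ the set of all finite words over $d$. Variable words. A variable word over $d$ is a finite or infinite sequence $v$ with entries in $\{0,\dots,d-1\}\cup\{x_0,x_1,\dots\}$ (the $x_m$ are variables). $P_{x_m}(v)=\{t: v(t)=x_m\}$; $x_m$ occurs in $v$ if $P_{x_m}(v)\neq\emptyset$, and then its first occurrence is $\min P_{x_m}(v)$. An $n$-variable word ($n\in\omega$ or $n=\omega$) is a variable word (infinite if $n=\omega$) in which exactly $n$ variables occur; it is assumed that whenever $x_m,x_{m'}$ both occur and $m<m'$, the first occurrence of $x_m$ is smaller than that of $x_{m'}$. Let $x_{m_0},x_{m_1},\dots$ with $m_0<m_1<\cdots$ be the variables occurring in an $n$-variable word $v$. For $\vec a\in d^{\hat n}$, $v(\vec a)$ is the word over $d$ obtained by replacing $x_{m_j}$ by $\vec a(j)$ for all $j<\min\{n,\hat n\}$ and then truncating just before the first occurrence of $x_{m_{\hat n}}$ (no truncation if $\hat n\ge n$). $\mathsf{VWI}(d,k)$.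 An instance is a coloring $c:d^{<\omega}\to k$. A solution of $c$ is an $\omega$-variable word $v$ over $d$ such that $c$ is constant on $\{v(\vec a):\vec a\in d^{<\omega}\}$. A solution is $c$-computable if it is computable relative to $c$ as an oracle. $\mathrm{ENSH}$. Let $n_0,\dots,n_{r-1}$ be a finite sequence of positive integers, $N=n_0+\cdots+n_{r-1}$, and for $s\le r-1$ let $N_s=\{n_0+\cdots+n_{s-1},\dots,n_0+\cdots+n_s-1\}$ (so $N_0=\{0,\dots,n_0-1\}$). Let $f:d^N\to k$. The sequence $n_0\cdots n_{r-1}$ is sectionally-homogeneous for $f$ if there exist $s\le r-1$ and an $n_s$-variable word $v$ over $d$ of length $N$ such that the set of first occurrences of the variables occurring in $v$ is exactly $N_s$, and $f$ is constant on $\{v(\vec a):\vec a\in d^{n_s}\}$. $\mathrm{ENSH}^d_k(n_0\cdots n_{r-1})$ holds if there exists $f:d^N\to k$ such that $n_0\cdots n_{r-1}$ is not sectionally-homogeneous for $f$. $\mathrm{ENSH}^d_k$ also denotes the set of infinite sequences of positive integers all of whose nonempty finite initial segments satisfy $\mathrm{ENSH}^d_k(\cdot)$. *)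

theory Defs
  imports
    Complex_Main
    "HOL-Library.Extended_Nat"
    "HOL-Library.FuncSet"
    "HOL-Library.Infinite_Set"
    "HOL-Library.Nat_Bijection"
begin

section \<open>Words and variable words\<close>

definition words :: "nat \<Rightarrow> nat list set" where
  "words d = lists {..<d}"

definition words_of_length :: "nat \<Rightarrow> nat \<Rightarrow> nat list set" where
  "words_of_length d n = {w \<in> words d. length w = n}"

datatype symb = Letter nat | Var nat

text \<open>
  A finite or infinite sequence of symbols is a partial function on the natural numbers whose
  domain is an initial segment (\<^term>\<open>UNIV\<close> for an infinite sequence).
\<close>

type_synonym symb_seq = "nat \<Rightarrow> symb option"

definition occurrences :: "symb_seq \<Rightarrow> nat \<Rightarrow> nat set" where
  "occurrences v m = {t. v t = Some (Var m)}"

definition vars :: "symb_seq \<Rightarrow> nat set" where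
  "vars v = {m. occurrences v m \<noteq> {}}"

definition first_occ :: "symb_seq \<Rightarrow> nat \<Rightarrow> nat" where
  "first_occ v m = (LEAST t. t \<in> occurrences v m)"

definition num_vars :: "symb_seq \<Rightarrow> enat" where
  "num_vars v = (if finite (vars v) then enat (card (vars v)) else \<infinity>)"

definition variable_word :: "nat \<Rightarrow> symb_seq \<Rightarrow> bool" where
  "variable_word d v \<longleftrightarrow>
     (\<exists>l::enat. dom v = {t. enat t < l}) \<and> (\<forall>a. Letter a \<in> ran v \<longrightarrow> a < d)"

definition n_variable_word :: "nat \<Rightarrow> enat \<Rightarrow> symb_seq \<Rightarrow> bool" where
  "n_variable_word d n v \<longleftrightarrow>
     variable_word d v \<and> (n = \<infinity> \<longrightarrow> dom v = UNIV) \<and> num_vars v = n \<and>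
     (\<forall>m\<in>vars v. \<forall>m'\<in>vars v. m < m' \<longrightarrow> first_occ v m < first_occ v m')"

text \<open>
  If the variables occurring in \<open>v\<close> are $x_{m_0}, x_{m_1}, \ldots$ with $m_0 < m_1 < \cdots$, then
  $m_j$ is \<^term>\<open>enumerate (vars v) j\<close>, and \<open>var_index v\<close> maps $m_j$ to $j$.
\<close>

definition var_index :: "symb_seq \<Rightarrow> nat \<Rightarrow> nat" where
  "var_index v m = card {m' \<in> vars v. m' < m}"

definition subst_symb :: "symb_seq \<Rightarrow> nat list \<Rightarrow> symb \<Rightarrow> nat" where
  "subst_symb v a s = (case s of Letter b \<Rightarrow> b | Var m \<Rightarrow> a ! var_index v m)"

definition subst_length :: "symb_seq \<Rightarrow> nat list \<Rightarrow> nat" where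
  "subst_length v a =
     (if enat (length a) < num_vars v
      then first_occ v (enumerate (vars v) (length a))
      else card (dom v))"

text \<open>
  The word $v(\vec a)$, for \<open>v\<close> finite or an \<open>\<omega>\<close>-variable word.  These are the cases in which
  $v(\vec a)$ is certainly finite: an infinite \<open>v\<close> with at most \<open>length a\<close> variables would not be
  truncated, and \<open>subst v a\<close> is then meaningless.
\<close>

definition subst :: "symb_seq \<Rightarrow> nat list \<Rightarrow> nat list" where
  "subst v a = map (\<lambda>t. subst_symb v a (the (v t))) [0..<subst_length v a]"


section \<open>Relative computability\<close>

text \<open>
  Programs for the partial recursive functions relative to an oracle \<open>g\<close>, with their evaluation
  relation: \<open>oeval g p xs y\<close> says that \<open>p\<close> with oracle \<open>g\<close> halts on the arguments \<open>xs\<close> with output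
  \<open>y\<close>.  Minimization is that of Kleene: \<open>Mu p\<close> returns the least \<open>n\<close> at which \<open>p\<close> is \<open>0\<close>, provided
  \<open>p\<close> halts at all smaller arguments.
\<close>

datatype oprog =
    Zero
  | Succ
  | Oracle
  | Proj nat
  | Comp oprog "oprog list"
  | Prec oprog oprog
  | Mu oprog

inductive oeval :: "(nat \<Rightarrow> nat) \<Rightarrow> oprog \<Rightarrow> nat list \<Rightarrow> nat \<Rightarrow> bool"
  for g :: "nat \<Rightarrow> nat"
where
  oeval_Zero: "oeval g Zero xs 0"
| oeval_Succ: "oeval g Succ [x] (Suc x)"
| oeval_Oracle: "oeval g Oracle [x] (g x)"
| oeval_Proj: "i < length xs \<Longrightarrow> oeval g (Proj i) xs (xs ! i)"
| oeval_Comp: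
    "\<lbrakk>length ys = length qs; \<forall>i<length qs. oeval g (qs ! i) xs (ys ! i); oeval g p ys z\<rbrakk>
      \<Longrightarrow> oeval g (Comp p qs) xs z"
| oeval_Prec_0: "oeval g p xs z \<Longrightarrow> oeval g (Prec p q) (0 # xs) z"
| oeval_Prec_Suc:
    "\<lbrakk>oeval g (Prec p q) (n # xs) y; oeval g q (n # y # xs) z\<rbrakk>
      \<Longrightarrow> oeval g (Prec p q) (Suc n # xs) z"
| oeval_Mu:
    "\<lbrakk>oeval g p (n # xs) 0; \<forall>i<n. \<exists>y>0. oeval g p (i # xs) y\<rbrakk> \<Longrightarrow> oeval g (Mu p) xs n"

definition computable_in :: "(nat \<Rightarrow> nat) \<Rightarrow> (nat \<Rightarrow> nat) \<Rightarrow> bool" where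
  "computable_in g f \<longleftrightarrow> (\<exists>p. \<forall>x. oeval g p [x] (f x))"


section \<open>The problem VWI\<close>

definition VWI_instance :: "nat \<Rightarrow> nat \<Rightarrow> (nat list \<Rightarrow> nat) \<Rightarrow> bool" where
  "VWI_instance d k c \<longleftrightarrow> c \<in> words d \<rightarrow> {..<k}"

definition VWI_solution :: "nat \<Rightarrow> (nat list \<Rightarrow> nat) \<Rightarrow> symb_seq \<Rightarrow> bool" where
  "VWI_solution d c v \<longleftrightarrow>
     n_variable_word d \<infinity> v \<and> (\<exists>j. \<forall>a\<in>words d. c (subst v a) = j)"

text \<open>
  The oracle given by a coloring must not carry the values of \<open>c\<close> outside \<^term>\<open>words d\<close>, which
  have no mathematical meaning.
\<close>

definition coloring_oracle :: "nat \<Rightarrow> (nat list \<Rightarrow> nat) \<Rightarrow> nat \<Rightarrow> nat" where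
  "coloring_oracle d c x = (if list_decode x \<in> words d then c (list_decode x) else 0)"

primrec symb_encode :: "symb \<Rightarrow> nat" where
  "symb_encode (Letter a) = 2 * a"
| "symb_encode (Var m) = 2 * m + 1"

definition coloring_computable :: "nat \<Rightarrow> (nat list \<Rightarrow> nat) \<Rightarrow> symb_seq \<Rightarrow> bool" where
  "coloring_computable d c v \<longleftrightarrow>
     dom v = UNIV \<and> computable_in (coloring_oracle d c) (\<lambda>t. symb_encode (the (v t)))"


section \<open>Sectional homogeneity and ENSH\<close>

definition section_positions :: "nat list \<Rightarrow> nat \<Rightarrow> nat set" where
  "section_positions ns s = {sum_list (take s ns)..<sum_list (take (Suc s) ns)}"

definition sectionally_homogeneous :: "nat \<Rightarrow> nat list \<Rightarrow> (nat list \<Rightarrow> nat) \<Rightarrow> bool" where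
  "sectionally_homogeneous d ns f \<longleftrightarrow>
     (\<exists>s<length ns. \<exists>v.
        n_variable_word d (enat (ns ! s)) v \<and>
        dom v = {..<sum_list ns} \<and>
        first_occ v ` vars v = section_positions ns s \<and>
        (\<exists>j. \<forall>a\<in>words_of_length d (ns ! s). f (subst v a) = j))"

definition ENSH :: "nat \<Rightarrow> nat \<Rightarrow> nat list \<Rightarrow> bool" where
  "ENSH d k ns \<longleftrightarrow>
     (\<exists>f. f \<in> words_of_length d (sum_list ns) \<rightarrow> {..<k} \<and> \<not> sectionally_homogeneous d ns f)"

definition ENSH_sequences :: "nat \<Rightarrow> nat \<Rightarrow> (nat \<Rightarrow> nat) set" where
  "ENSH_sequences d k = {X. (\<forall>i. X i > 0) \<and> (\<forall>r>0. ENSH d k (map X [0..<r]))}"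

end

theory Submission
  imports Defs "HOL-Library.Countable"
begin

text \<open>
  Given \<open>X\<close> in $\mathrm{ENSH}$, with bad colorings \<open>F r\<close> of the words of length
  $n_0 + \cdots + n_{r-1}$, define \<open>c\<close> by recursion on the length of the word. From the values of
  \<open>c\<close> on words shorter than \<open>M\<close> one sees initial segments of the sequences computed by the first
  \<open>M\<close> programs. Go through these programs and give each that already shows enough new variables the
  next block of positions, namely first occurrences of its variables; then color a word \<open>w\<close> of
  length \<open>M\<close> by \<open>F r\<close> of the restriction of \<open>w\<close> to the reserved positions. The block of a given
  program is eventually constant in \<open>M\<close> (a finite injury argument), and if that program computed a
  solution, \<open>F r\<close> would be homogeneous for the section of this block.

  Conversely, call a word \<open>q\<close> extensible for the color \<open>j\<close> if behind \<open>q\<close> every finite variable word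
  continues, without new variables, to one all of whose instances have color \<open>j\<close>. If some \<open>q\<close> is
  extensible, a greedy search computes a solution from \<open>c\<close>. If none is, every finite variable word
  can be prolonged so that no continuation without new variables is monochromatic, and this for all
  the finitely many \<open>q\<close> of a given length at once. Prolonging again and again, each time with new
  variables, gives an infinite variable word; \<open>X\<close> counts the variables added in the steps, and the
  color of its instances witnesses $\mathrm{ENSH}$ for every initial segment.
\<close>

section \<open>Closure properties of relative computability\<close>

text \<open>Arguments come as one list of fixed length \<open>n\<close>, so functions compose as
  terms in \<open>xs\<close>; lists of other lengths are left unconstrained.\<close>

definition ocomp :: "(nat \<Rightarrow> nat) \<Rightarrow> nat \<Rightarrow> (nat list \<Rightarrow> nat) \<Rightarrow> bool" where
  "ocomp g n F \<longleftrightarrow> (\<exists>p. \<forall>xs. length xs = n \<longrightarrow> oeval g p xs (F xs))"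

lemma ocomp_cong:
  assumes "ocomp g n F" "\<And>xs. length xs = n \<Longrightarrow> F xs = G xs"
  shows "ocomp g n G"
  using assms unfolding ocomp_def by metis

lemma ocomp_proj: "i < n \<Longrightarrow> ocomp g n (\<lambda>xs. xs ! i)"
  unfolding ocomp_def by (auto intro: exI[of _ "Proj i"] oeval_Proj)

lemma ocomp_comp1:
  assumes "ocomp g 1 (\<lambda>xs. h (xs ! 0))" "ocomp g n A"
  shows "ocomp g n (\<lambda>xs. h (A xs))"
proof -
  obtain p q where pq: "\<And>xs. length xs = 1 \<Longrightarrow> oeval g p xs (h (xs ! 0))"
    "\<And>xs. length xs = n \<Longrightarrow> oeval g q xs (A xs)"
    using assms unfolding ocomp_def by blast
  have "oeval g (Comp p [q]) xs (h (A xs))" if "length xs = n" for xs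
    using pq(1)[of "[A xs]"] pq(2)[OF that] by (auto intro!: oeval_Comp[where ys = "[A xs]"])
  then show ?thesis unfolding ocomp_def by blast
qed

lemma ocomp_comp2:
  assumes "ocomp g 2 (\<lambda>xs. h (xs ! 0) (xs ! 1))" "ocomp g n A" "ocomp g n B"
  shows "ocomp g n (\<lambda>xs. h (A xs) (B xs))"
proof -
  obtain p q r where pq: "\<And>xs. length xs = 2 \<Longrightarrow> oeval g p xs (h (xs ! 0) (xs ! 1))"
    "\<And>xs. length xs = n \<Longrightarrow> oeval g q xs (A xs)" "\<And>xs. length xs = n \<Longrightarrow> oeval g r xs (B xs)"
    using assms unfolding ocomp_def by blast
  have "oeval g (Comp p [q, r]) xs (h (A xs) (B xs))" if "length xs = n" for xs
    using pq(1)[of "[A xs, B xs]"] pq(2,3)[OF that]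
    by (auto intro!: oeval_Comp[where ys = "[A xs, B xs]"] simp: less_Suc_eq)
  then show ?thesis unfolding ocomp_def by blast
qed

text \<open>\<open>Prec\<close> takes its counter as first argument; composing it with the program
  for \<open>K\<close> and the projections puts \<open>K xs\<close> there and keeps
  \<open>xs\<close> as parameters.\<close>

lemma ocomp_rec:
  assumes "ocomp g n A" "ocomp g (Suc (Suc n)) B" "ocomp g n K"
  shows "ocomp g n (\<lambda>xs. rec_nat (A xs) (\<lambda>i y. B (i # y # xs)) (K xs))"
proof -
  obtain p q r where pq: "\<And>xs. length xs = n \<Longrightarrow> oeval g p xs (A xs)"
    "\<And>xs. length xs = Suc (Suc n) \<Longrightarrow> oeval g q xs (B xs)"
    "\<And>xs. length xs = n \<Longrightarrow> oeval g r xs (K xs)"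
    using assms unfolding ocomp_def by blast
  have prec: "oeval g (Prec p q) (k # xs) (rec_nat (A xs) (\<lambda>i y. B (i # y # xs)) k)"
    if "length xs = n" for k xs
    by (induction k) (use pq that in \<open>auto intro: oeval_Prec_0 oeval_Prec_Suc\<close>)
  have "oeval g (Comp (Prec p q) (r # map Proj [0..<n])) xs
         (rec_nat (A xs) (\<lambda>i y. B (i # y # xs)) (K xs))" if len: "length xs = n" for xs
  proof (rule oeval_Comp[where ys = "K xs # xs"])
    show "\<forall>i<length (r # map Proj [0..<n]).
        oeval g ((r # map Proj [0..<n]) ! i) xs ((K xs # xs) ! i)"
      using pq(3)[OF len] len by (auto simp: less_Suc_eq_0_disj intro: oeval_Proj)
  qed (use len prec in auto)
  then show ?thesis unfolding ocomp_def by blast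
qed

lemma ocomp_const: "ocomp g n (\<lambda>xs. a)"
proof -
  have "\<exists>p. \<forall>xs. oeval g p xs a"
  proof (induction a)
    case 0
    then show ?case by (auto intro: oeval_Zero)
  next
    case (Suc a)
    then obtain p where p: "oeval g p xs a" for xs by blast
    have "oeval g (Comp Succ [p]) xs (Suc a)" for xs
      by (rule oeval_Comp[where ys = "[a]"]) (use p in \<open>auto intro: oeval_Succ\<close>)
    then show ?case by blast
  qed
  then show ?thesis unfolding ocomp_def by blast
qed

lemma ocomp_Suc0: "ocomp g 1 (\<lambda>xs. Suc (xs ! 0))"
  unfolding ocomp_def by (rule exI[of _ Succ]) (auto simp: length_Suc_conv intro: oeval_Succ)

lemmas ocomp_Suc = ocomp_comp1[where h = Suc, OF ocomp_Suc0]

lemma ocomp_oracle0: "ocomp g 1 (\<lambda>xs. g (xs ! 0))"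
  unfolding ocomp_def by (rule exI[of _ Oracle]) (auto simp: length_Suc_conv intro: oeval_Oracle)

lemmas ocomp_oracle = ocomp_comp1[where h = g and g = g for g, OF ocomp_oracle0]

lemma ocomp_computable_in: "ocomp g 1 (\<lambda>xs. f (xs ! 0)) \<Longrightarrow> computable_in g f"
  unfolding ocomp_def computable_in_def by (metis One_nat_def length_Cons list.size(3) nth_Cons_0)

lemma ocomp_add:
  assumes "ocomp g n A" "ocomp g n B"
  shows "ocomp g n (\<lambda>xs. A xs + B xs)"
proof -
  have "rec_nat a (\<lambda>i y. Suc y) b = a + b" for a b by (induction b) auto
  then show ?thesis
    using ocomp_rec[OF assms(1) ocomp_Suc[OF ocomp_proj[of 1]] assms(2)] by simp
qed

lemma ocomp_mult:
  assumes "ocomp g n A" "ocomp g n B"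
  shows "ocomp g n (\<lambda>xs. A xs * B xs)"
proof -
  have *: "rec_nat 0 (\<lambda>i y. y + a) b = a * b" for a b :: nat by (induction b) auto
  \<comment> \<open>The recursion body sees only the counter, the previous value and the parameters,
    so both factors are first made parameters; \<open>xs ! 0\<close> then has index 2.\<close>
  have "ocomp g 2 (\<lambda>xs. rec_nat 0 (\<lambda>i y. y + (xs ! 0)) (xs ! 1))"
    using ocomp_rec[OF ocomp_const[of _ _ 0]
        ocomp_add[OF ocomp_proj[of 1] ocomp_proj[of 2]] ocomp_proj[of 1 2]] by (simp add: numeral_2_eq_2)
  from ocomp_comp2[where h = "(*)", OF this[unfolded *] assms] show ?thesis .
qed

lemma ocomp_power:
  assumes "ocomp g n A" "ocomp g n B"
  shows "ocomp g n (\<lambda>xs. A xs ^ B xs)"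
proof -
  have *: "rec_nat 1 (\<lambda>i y. y * a) b = a ^ b" for a b :: nat by (induction b) auto
  have "ocomp g 2 (\<lambda>xs. rec_nat 1 (\<lambda>i y. y * (xs ! 0)) (xs ! 1))"
    using ocomp_rec[OF ocomp_const[of _ _ 1]
        ocomp_mult[OF ocomp_proj[of 1] ocomp_proj[of 2]] ocomp_proj[of 1 2]] by (simp add: numeral_2_eq_2)
  from ocomp_comp2[where h = "(^)", OF this[unfolded *] assms] show ?thesis .
qed

lemma ocomp_diff:
  assumes "ocomp g n A" "ocomp g n B"
  shows "ocomp g n (\<lambda>xs. A xs - B xs)"
proof -
  have *: "rec_nat 0 (\<lambda>i y. i) b = b - 1" for b :: nat by (cases b) auto
  have "ocomp g 1 (\<lambda>xs. xs ! 0 - 1)"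
    using ocomp_rec[OF ocomp_const[of _ _ 0] ocomp_proj[of 0] ocomp_proj[of 0 1], of g]
    by (simp add: *)
  note pred = ocomp_comp1[where h = "\<lambda>x. x - 1", OF this]
  have **: "rec_nat a (\<lambda>i y. y - 1) b = a - b" for a b :: nat by (induction b) auto
  show ?thesis
    using ocomp_rec[OF assms(1) pred[OF ocomp_proj[of 1]] assms(2)] ** by simp
qed

text \<open>Truth is coded by \<open>0\<close>, the value that stops a minimization.\<close>

definition odec :: "(nat \<Rightarrow> nat) \<Rightarrow> nat \<Rightarrow> (nat list \<Rightarrow> bool) \<Rightarrow> bool" where
  "odec g n P \<longleftrightarrow> ocomp g n (\<lambda>xs. if P xs then 0 else 1)"

lemma odec_le:
  assumes "ocomp g n A" "ocomp g n B"
  shows "odec g n (\<lambda>xs. A xs \<le> B xs)"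
  unfolding odec_def
  \<comment> \<open>The code is \<open>1 - (1 - (A xs - B xs))\<close> in truncated
    subtraction.\<close>
  by (rule ocomp_cong[OF ocomp_diff[OF ocomp_const[of _ _ 1]
          ocomp_diff[OF ocomp_const[of _ _ 1] ocomp_diff[OF assms]]]]) auto

lemma odec_not:
  assumes "odec g n P"
  shows "odec g n (\<lambda>xs. \<not> P xs)"
  unfolding odec_def
  by (rule ocomp_cong[OF ocomp_diff[OF ocomp_const[of _ _ 1] assms[unfolded odec_def]]]) auto

lemma odec_or:
  assumes "odec g n P" "odec g n Q"
  shows "odec g n (\<lambda>xs. P xs \<or> Q xs)"
  unfolding odec_def
  by (rule ocomp_cong[OF ocomp_mult[OF assms[unfolded odec_def]]]) auto

lemma odec_and:
  assumes "odec g n P" "odec g n Q"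
  shows "odec g n (\<lambda>xs. P xs \<and> Q xs)"
  using odec_not[OF odec_or[OF odec_not[OF assms(1)] odec_not[OF assms(2)]]] by simp

lemma odec_less:
  assumes "ocomp g n A" "ocomp g n B"
  shows "odec g n (\<lambda>xs. A xs < B xs)"
  using odec_not[OF odec_le[OF assms(2,1)]] by (simp add: not_le)

lemma odec_eq:
  assumes "ocomp g n A" "ocomp g n B"
  shows "odec g n (\<lambda>xs. A xs = B xs)"
  using odec_and[OF odec_le[OF assms] odec_le[OF assms(2,1)]] by (simp add: eq_iff)

lemma ocomp_if:
  assumes "odec g n P" "ocomp g n A" "ocomp g n B"
  shows "ocomp g n (\<lambda>xs. if P xs then A xs else B xs)"
  using assms(1)[unfolded odec_def]
  by (rule ocomp_cong[OF ocomp_add[OF ocomp_mult[OF ocomp_diff[OF ocomp_const[of _ _ 1]] assms(2)]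
          ocomp_mult[OF assms(1)[unfolded odec_def] assms(3)]]]) auto

text \<open>The body of a recursion also receives the previous value; here it is discarded.\<close>

lemma ocomp_skip:
  assumes "ocomp g (Suc n) F" "ocomp g (Suc (Suc n)) I"
  shows "ocomp g (Suc (Suc n)) (\<lambda>ys. F (I ys # drop 2 ys))"
proof -
  obtain p q where p: "\<And>xs. length xs = Suc n \<Longrightarrow> oeval g p xs (F xs)"
    and q: "\<And>xs. length xs = Suc (Suc n) \<Longrightarrow> oeval g q xs (I xs)"
    using assms unfolding ocomp_def by blast
  let ?qs = "q # map (\<lambda>i. Proj (i + 2)) [0..<n]"
  have "oeval g (Comp p ?qs) ys (F (I ys # drop 2 ys))" if len: "length ys = Suc (Suc n)" for ys
  proof (rule oeval_Comp[where ys = "I ys # drop 2 ys"])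
    show "\<forall>i<length ?qs. oeval g (?qs ! i) ys ((I ys # drop 2 ys) ! i)"
    proof (intro allI impI)
      fix i assume i: "i < length ?qs"
      show "oeval g (?qs ! i) ys ((I ys # drop 2 ys) ! i)"
      proof (cases i)
        case 0
        then show ?thesis using q[OF len] by simp
      next
        case (Suc j)
        then show ?thesis using oeval_Proj[of "j + 2" ys g] len i by (simp add: add.commute)
      qed
    qed
  qed (use len p in auto)
  then show ?thesis unfolding ocomp_def by blast
qed

text \<open>The recursion carries a flag: \<open>0\<close> until some \<open>i\<close> violates
  \<open>P\<close>, and \<open>1\<close> ever after.\<close>

lemma odec_ball:
  assumes "odec g (Suc n) P" "ocomp g n K"
  shows "odec g n (\<lambda>xs. \<forall>i<K xs. P (i # xs))"
proof -
  have "odec g (Suc (Suc n)) (\<lambda>ys. P (ys ! 0 # drop 2 ys))"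
    using ocomp_skip[OF assms(1)[unfolded odec_def] ocomp_proj[of 0]] unfolding odec_def by simp
  from ocomp_if[OF this ocomp_proj[of 1] ocomp_const[of _ _ 1]]
  have "ocomp g (Suc (Suc n)) (\<lambda>ys. if P (ys ! 0 # drop 2 ys) then ys ! 1 else 1)"
    by simp
  from ocomp_rec[OF ocomp_const[of _ _ 0] this assms(2)]
  have 1: "ocomp g n (\<lambda>xs. rec_nat 0 (\<lambda>i y. if P (i # xs) then y else 1) (K xs))"
    by (simp cong: if_cong)
  have 2: "rec_nat 0 (\<lambda>i y. if P (i # xs) then y else 1) k = (if \<forall>i<k. P (i # xs) then 0 else 1)"
    for xs k by (induction k) (auto simp: less_Suc_eq)
  show ?thesis using 1 unfolding odec_def 2 .
qed

lemma odec_bex: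
  assumes "odec g (Suc n) P" "ocomp g n K"
  shows "odec g n (\<lambda>xs. \<exists>i<K xs. P (i # xs))"
  using odec_not[OF odec_ball[OF odec_not[OF assms(1)] assms(2)]] by simp

text \<open>The existence hypothesis makes the search of \<open>Mu\<close> total; the code
  \<open>1\<close> of falsity is the positive value that \<open>Mu\<close> requires below its
  result.\<close>

lemma ocomp_Least:
  assumes "odec g (Suc n) P" "\<And>xs. length xs = n \<Longrightarrow> \<exists>i. P (i # xs)"
  shows "ocomp g n (\<lambda>xs. LEAST i. P (i # xs))"
proof -
  obtain p where p: "\<And>xs. length xs = Suc n \<Longrightarrow> oeval g p xs (if P xs then 0 else 1)"
    using assms(1) unfolding odec_def ocomp_def by blast
  have "oeval g (Mu p) xs (LEAST i. P (i # xs))" if len: "length xs = n" for xs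
  proof (rule oeval_Mu)
    show "oeval g p ((LEAST i. P (i # xs)) # xs) 0"
      using p[of "(LEAST i. P (i # xs)) # xs"] len LeastI_ex[OF assms(2)[OF len]] by simp
    show "\<forall>i<LEAST i. P (i # xs). \<exists>y>0. oeval g p (i # xs) y"
    proof (intro allI impI)
      fix i assume "i < (LEAST i. P (i # xs))"
      then have "\<not> P (i # xs)" by (rule not_less_Least)
      then show "\<exists>y>0. oeval g p (i # xs) y" using p[of "i # xs"] len by auto
    qed
  qed
  then show ?thesis unfolding ocomp_def by blast
qed

section \<open>Division and pairing\<close>

lemma ocomp_div:
  assumes "ocomp g n A" "ocomp g n B"
  shows "ocomp g n (\<lambda>xs. A xs div B xs)"
proof -
  \<comment> \<open>For \<open>b = 0\<close> the second disjunct stops the search at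
    \<open>0\<close>, the value of \<open>a div 0\<close>.\<close>
  have *: "(LEAST q. a < b * Suc q \<or> b = 0) = a div b" for a b :: nat
  proof (cases "b = 0")
    case False
    show ?thesis
    proof (rule Least_equality)
      show "a < b * Suc (a div b) \<or> b = 0"
        using False dividend_less_times_div[of b a] by simp
    next
      fix q assume "a < b * Suc q \<or> b = 0"
      then have "a < Suc q * b" using False by (simp add: mult.commute)
      then have "a div b < Suc q" by (rule less_mult_imp_div_less)
      then show "a div b \<le> q" by simp
    qed
  qed simp
  have d: "odec g 3 (\<lambda>xs. xs ! 1 < xs ! 2 * Suc (xs ! 0) \<or> xs ! 2 = 0)"
    by (intro odec_or odec_less odec_eq ocomp_mult ocomp_Suc ocomp_proj ocomp_const) auto
  have ex: "\<exists>q. a < b * Suc q \<or> b = 0" for a b :: nat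
    by (metis dividend_less_times_div mult_Suc_right not_gr_zero)
  have "ocomp g 2 (\<lambda>xs. LEAST q. (\<lambda>ys. ys ! 1 < ys ! 2 * Suc (ys ! 0) \<or> ys ! 2 = 0) (q # xs))"
    by (rule ocomp_Least) (use d ex in \<open>auto simp: numeral_3_eq_3 numeral_2_eq_2\<close>)
  then have "ocomp g 2 (\<lambda>xs. xs ! 0 div xs ! 1)"
    using * by (simp add: numeral_2_eq_2)
  from ocomp_comp2[where h = "(div)", OF this assms] show ?thesis .
qed

lemma ocomp_mod:
  assumes "ocomp g n A" "ocomp g n B"
  shows "ocomp g n (\<lambda>xs. A xs mod B xs)"
  using ocomp_diff[OF assms(1) ocomp_mult[OF assms(2) ocomp_div[OF assms]]]
  by (simp add: minus_mult_div_eq_mod)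

lemma ocomp_prod_encode:
  assumes "ocomp g n A" "ocomp g n B"
  shows "ocomp g n (\<lambda>xs. prod_encode (A xs, B xs))"
  unfolding prod_encode_def triangle_def
  using ocomp_add[OF ocomp_div[OF ocomp_mult[OF ocomp_add[OF assms] ocomp_Suc[OF ocomp_add[OF assms]]]
        ocomp_const[of _ _ 2]] assms(1)] by simp

lemma ocomp_fst_snd:
  assumes "ocomp g n A"
  shows ocomp_fst: "ocomp g n (\<lambda>xs. fst (prod_decode (A xs)))"
    and ocomp_snd: "ocomp g n (\<lambda>xs. snd (prod_decode (A xs)))"
proof -
  \<comment> \<open>Each component of a code is at most the code, so one is found by unbounded
    search while the other is bounded; equality can occur, hence \<open>Suc z\<close>.\<close>
  have 1: "(LEAST a. \<exists>b<Suc z. prod_encode (a, b) = z) = fst (prod_decode z)" for z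
  proof (rule Least_equality)
    show "\<exists>b<Suc z. prod_encode (fst (prod_decode z), b) = z"
      by (metis le_imp_less_Suc le_prod_encode_2 prod.collapse prod_decode_inverse)
  qed auto
  have 2: "(LEAST b. \<exists>a<Suc z. prod_encode (a, b) = z) = snd (prod_decode z)" for z
  proof (rule Least_equality)
    show "\<exists>a<Suc z. prod_encode (a, snd (prod_decode z)) = z"
      by (metis le_imp_less_Suc le_prod_encode_1 prod.collapse prod_decode_inverse)
  qed auto
  have ex1: "\<exists>a. \<exists>b<Suc z. prod_encode (a, b) = z" for z
    by (metis le_imp_less_Suc le_prod_encode_2 prod.collapse prod_decode_inverse)
  have ex2: "\<exists>b. \<exists>a<Suc z. prod_encode (a, b) = z" for z
    by (metis le_imp_less_Suc le_prod_encode_1 prod.collapse prod_decode_inverse)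
  have d1: "odec g 2 (\<lambda>xs. \<exists>b<Suc (xs ! 1). (\<lambda>ys. prod_encode (ys ! 1, ys ! 0) = ys ! 2) (b # xs))"
    and d2: "odec g 2 (\<lambda>xs. \<exists>b<Suc (xs ! 1). (\<lambda>ys. prod_encode (ys ! 0, ys ! 1) = ys ! 2) (b # xs))"
    by (intro odec_bex odec_eq ocomp_prod_encode ocomp_Suc ocomp_proj; simp)+
  have "ocomp g 1 (\<lambda>xs. LEAST a. (\<lambda>xs. \<exists>b<Suc (xs ! 1). (\<lambda>ys. prod_encode (ys ! 1, ys ! 0) = ys ! 2) (b # xs)) (a # xs))"
    by (rule ocomp_Least) (use d1 ex1 in \<open>auto simp: numeral_2_eq_2\<close>)
  then have "ocomp g 1 (\<lambda>xs. fst (prod_decode (xs ! 0)))"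
    using 1 by (simp add: numeral_2_eq_2)
  from ocomp_comp1[where h = "\<lambda>x. fst (prod_decode x)", OF this assms]
  show "ocomp g n (\<lambda>xs. fst (prod_decode (A xs)))" .
  have "ocomp g 1 (\<lambda>xs. LEAST a. (\<lambda>xs. \<exists>b<Suc (xs ! 1). (\<lambda>ys. prod_encode (ys ! 0, ys ! 1) = ys ! 2) (b # xs)) (a # xs))"
    by (rule ocomp_Least) (use d2 ex2 in \<open>auto simp: numeral_2_eq_2\<close>)
  then have "ocomp g 1 (\<lambda>xs. snd (prod_decode (xs ! 0)))"
    using 2 by (simp add: numeral_2_eq_2)
  from ocomp_comp1[where h = "\<lambda>x. snd (prod_decode x)", OF this assms]
  show "ocomp g n (\<lambda>xs. snd (prod_decode (A xs)))" .
qed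

section \<open>Operations on coded lists\<close>

lemma ocomp_tl:
  assumes "ocomp g n A"
  shows "ocomp g n (\<lambda>xs. list_encode (tl (list_decode (A xs))))"
proof -
  \<comment> \<open>A nonempty list is coded by the successor of the pair of its head and the code
    of its tail; \<open>0\<close> codes the empty list.\<close>
  have *: "list_encode (tl (list_decode z)) = (if z = 0 then 0 else snd (prod_decode (z - 1)))" for z
    by (cases z) (auto split: prod.splits)
  show ?thesis
    unfolding * by (intro ocomp_if odec_eq ocomp_snd ocomp_diff ocomp_const assms)
qed

lemma ocomp_drop:
  assumes "ocomp g n A" "ocomp g n K"
  shows "ocomp g n (\<lambda>xs. list_encode (drop (K xs) (list_decode (A xs))))"
proof -
  have *: "rec_nat z (\<lambda>i y. list_encode (tl (list_decode y))) k = list_encode (drop k (list_decode z))"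
    for z k by (induction k) (auto simp: drop_Suc tl_drop)
  show ?thesis
    using ocomp_rec[OF assms(1) ocomp_tl[OF ocomp_proj[of 1]] assms(2)] * by simp
qed

lemma ocomp_length:
  assumes "ocomp g n A"
  shows "ocomp g n (\<lambda>xs. length (list_decode (A xs)))"
proof -
  have *: "(LEAST i. list_encode (drop i (list_decode z)) = 0) = length (list_decode z)" for z
  proof -
    have "list_encode xs = 0 \<longleftrightarrow> xs = []" for xs by (cases xs) auto
    then show ?thesis by (auto intro: Least_equality)
  qed
  have d: "odec g 2 (\<lambda>ys. list_encode (drop (ys ! 0) (list_decode (ys ! 1))) = 0)"
    by (intro odec_eq ocomp_drop ocomp_const ocomp_proj) auto
  have "ocomp g 1 (\<lambda>xs. LEAST i. (\<lambda>ys. list_encode (drop (ys ! 0) (list_decode (ys ! 1))) = 0) (i # xs))"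
  proof (rule ocomp_Least)
    fix xs :: "nat list"
    show "\<exists>i. (\<lambda>ys. list_encode (drop (ys ! 0) (list_decode (ys ! 1))) = 0) (i # xs)"
      by (rule exI[of _ "length (list_decode (xs ! 0))"]) simp
  qed (use d in \<open>simp add: numeral_2_eq_2\<close>)
  then have "ocomp g 1 (\<lambda>xs. length (list_decode (xs ! 0)))"
    by (simp add: *)
  from ocomp_comp1[where h = "\<lambda>x. length (list_decode x)", OF this assms] show ?thesis .
qed

text \<open>\<open>!\<close> is unspecified past the end of a list and could not be shown computable
  there; this version returns \<open>0\<close>.\<close>

definition code_nth :: "nat \<Rightarrow> nat \<Rightarrow> nat" where
  "code_nth z i = fst (prod_decode (list_encode (drop i (list_decode z)) - 1))"

lemma code_nth_eq: "i < length (list_decode z) \<Longrightarrow> code_nth z i = list_decode z ! i"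
  by (simp add: code_nth_def Cons_nth_drop_Suc[symmetric])

lemma ocomp_nth:
  assumes "ocomp g n A" "ocomp g n K"
  shows "ocomp g n (\<lambda>xs. code_nth (A xs) (K xs))"
  unfolding code_nth_def by (intro ocomp_fst ocomp_diff ocomp_drop ocomp_const assms)

text \<open>List codes are built from the head, so the table is filled from its end: step
  \<open>i\<close> puts entry \<open>l - Suc i\<close> in front, where \<open>l\<close> is the final
  length.\<close>

lemma ocomp_tabulate:
  assumes "ocomp g (Suc n) F" "ocomp g n K"
  shows "ocomp g n (\<lambda>xs. list_encode (map (\<lambda>i. F (i # xs)) [0..<K xs]))"
proof -
  \<comment> \<open>Here \<open>ys\<close> consists of the counter, the code so far, the final
    length and the parameters.\<close>
  have skip: "ocomp g (Suc (Suc (Suc n))) (\<lambda>ys. F ((ys ! 2 - Suc (ys ! 0)) # drop 3 ys))"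
  proof -
    have 1: "ocomp g (Suc (Suc n)) (\<lambda>ys. F (ys ! 0 # drop 2 ys))"
      using ocomp_skip[OF assms(1) ocomp_proj[of 0]] by simp
    have "ocomp g (Suc (Suc (Suc n)))
        (\<lambda>zs. (\<lambda>ys. F (ys ! 0 # drop 2 ys)) ((zs ! 2 - Suc (zs ! 0)) # drop 2 zs))"
      by (intro ocomp_skip[OF 1] ocomp_diff ocomp_Suc ocomp_proj) auto
    then show ?thesis by (simp add: numeral_3_eq_3 numeral_2_eq_2 drop_Suc)
  qed
  have step: "ocomp g (Suc (Suc (Suc n)))
      (\<lambda>ys. Suc (prod_encode (F ((ys ! 2 - Suc (ys ! 0)) # drop 3 ys), ys ! 1)))"
    by (intro ocomp_Suc ocomp_prod_encode skip ocomp_proj) auto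
  let ?f = "\<lambda>l i xs. F ((l - Suc i) # xs)"
  have *: "rec_nat 0 (\<lambda>i y. Suc (prod_encode (?f l i xs, y))) k
      = list_encode (map (\<lambda>i. F (i # xs)) [l - k..<l])" if "k \<le> l" for l k xs
    using that
  proof (induction k)
    case (Suc k)
    then have "[l - Suc k..<l] = (l - Suc k) # [l - k..<l]"
      by (simp add: Suc_diff_Suc upt_conv_Cons)
    then show ?case using Suc by simp
  qed simp
  have "ocomp g (Suc n) (\<lambda>xs. rec_nat 0 (\<lambda>i y. Suc (prod_encode
      (F (((i # y # xs) ! 2 - Suc ((i # y # xs) ! 0)) # drop 3 (i # y # xs)), (i # y # xs) ! 1))) (xs ! 0))"
    using ocomp_rec[OF ocomp_const[of _ _ 0] step ocomp_proj[of 0 "Suc n"]] by simp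
  then have tab: "ocomp g (Suc n) (\<lambda>xs. rec_nat 0 (\<lambda>i y. Suc (prod_encode (?f (xs ! 0) i (tl xs), y))) (xs ! 0))"
    by (simp add: numeral_3_eq_3 numeral_2_eq_2 drop_Suc)
  obtain p r where p: "\<And>xs. length xs = Suc n \<Longrightarrow>
      oeval g p xs (rec_nat 0 (\<lambda>i y. Suc (prod_encode (?f (xs ! 0) i (tl xs), y))) (xs ! 0))"
    and r: "\<And>xs. length xs = n \<Longrightarrow> oeval g r xs (K xs)"
    using tab assms(2) unfolding ocomp_def by blast
  have "oeval g (Comp p (r # map Proj [0..<n])) xs
         (list_encode (map (\<lambda>i. F (i # xs)) [0..<K xs]))" if len: "length xs = n" for xs
  proof (rule oeval_Comp[where ys = "K xs # xs"])
    show "\<forall>i<length (r # map Proj [0..<n]).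
        oeval g ((r # map Proj [0..<n]) ! i) xs ((K xs # xs) ! i)"
      using r[OF len] len by (auto simp: less_Suc_eq_0_disj intro: oeval_Proj)
    show "oeval g p (K xs # xs) (list_encode (map (\<lambda>i. F (i # xs)) [0..<K xs]))"
      using p[of "K xs # xs"] len *[of "K xs" "K xs" xs] by simp
  qed (use len in auto)
  then show ?thesis unfolding ocomp_def by blast
qed

lemma ocomp_append:
  assumes "ocomp g n A" "ocomp g n B"
  shows "ocomp g n (\<lambda>xs. list_encode (list_decode (A xs) @ list_decode (B xs)))"
proof -
  let ?l = "\<lambda>z. length (list_decode z)"
  let ?F = "\<lambda>ys. if ys ! 0 < ?l (ys ! 1) then code_nth (ys ! 1) (ys ! 0)
    else code_nth (ys ! 2) (ys ! 0 - ?l (ys ! 1))"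
  have "ocomp g 2 (\<lambda>xs. list_encode (map (\<lambda>i. ?F (i # xs)) [0..<?l (xs ! 0) + ?l (xs ! 1)]))"
    by (intro ocomp_tabulate ocomp_if odec_less ocomp_nth ocomp_length ocomp_diff ocomp_add ocomp_proj)
       simp_all
  moreover have "map (\<lambda>i. ?F (i # xs)) [0..<?l (xs ! 0) + ?l (xs ! 1)]
      = list_decode (xs ! 0) @ list_decode (xs ! 1)" for xs
    by (rule nth_equalityI) (auto simp: code_nth_eq nth_append)
  ultimately have "ocomp g 2 (\<lambda>xs. list_encode (list_decode (xs ! 0) @ list_decode (xs ! 1)))"
    by simp
  from ocomp_comp2[where h = "\<lambda>x y. list_encode (list_decode x @ list_decode y)", OF this assms]
  show ?thesis .
qed

section \<open>The greedy search\<close>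

text \<open>
  From here on a variable word is a list of numbers in which \<open>s < d\<close> stands for a letter and
  \<open>d + i\<close> for the variable \<open>x\<^sub>i\<close>; the variables need not occur in order.
\<close>

definition inst :: "nat \<Rightarrow> (nat \<Rightarrow> nat) \<Rightarrow> nat list \<Rightarrow> nat list" where
  "inst d b e = map (\<lambda>s. if s < d then s else b (s - d)) e"

text \<open>No new variable enters \<open>w\<close>, so the greedy search itself decides when the
  next variable appears.\<close>

definition extensible :: "nat \<Rightarrow> (nat list \<Rightarrow> nat) \<Rightarrow> nat list \<Rightarrow> nat \<Rightarrow> bool" where
  "extensible d c q j \<longleftrightarrow> (\<forall>m e. set e \<subseteq> {..<d + m} \<longrightarrow>
     (\<exists>w. set w \<subseteq> {..<d + m} \<and> (\<forall>b. range b \<subseteq> {..<d} \<longrightarrow> c (q @ inst d b (e @ w)) = j)))"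

lemma inst_append [simp]: "inst d b (e @ e') = inst d b e @ inst d b e'"
  by (simp add: inst_def)

lemma length_inst [simp]: "length (inst d b e) = length e"
  by (simp add: inst_def)

lemma inst_in_words: "range b \<subseteq> {..<d} \<Longrightarrow> inst d b e \<in> words d"
  by (force simp: inst_def words_def)

lemma inst_cong: "set e \<subseteq> {..<d + m} \<Longrightarrow> (\<And>i. i < m \<Longrightarrow> b i = b' i) \<Longrightarrow> inst d b e = inst d b' e"
  by (auto simp: inst_def subset_iff)

lemma words_append [simp]: "u @ w \<in> words d \<longleftrightarrow> u \<in> words d \<and> w \<in> words d"
  by (auto simp: words_def)

lemma words_nth: "w \<in> words d \<Longrightarrow> i < length w \<Longrightarrow> w ! i < d"
  by (auto simp: words_def)

lemma enumerate_UNIV [simp]: "enumerate (UNIV :: nat set) n = n"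
proof (induction n)
  case 0
  then show ?case by (simp add: enumerate_0)
next
  case (Suc n)
  then show ?case by (auto simp: enumerate_Suc'' intro!: Least_equality)
qed

text \<open>Variable \<open>i\<close> first occurs right after \<open>e i @ w i\<close>, so
  substituting a word of length \<open>i\<close> into the limit \<open>v\<close> truncates it to
  \<open>q\<close> followed by an instance of \<open>e i @ w i\<close>. Entry \<open>t\<close>
  behind \<open>q\<close> can be read off \<open>e (Suc t)\<close>, which is longer than
  \<open>t\<close>.\<close>

lemma chain_solution:
  fixes e w :: "nat \<Rightarrow> nat list"
  assumes e0: "e 0 = []" and eS: "\<And>i. e (Suc i) = e i @ w i @ [d + i]"
    and w: "\<And>i. set (w i) \<subseteq> {..<d + i}" and q: "q \<in> words d" and d: "d > 0"
    and const: "\<And>i b. range b \<subseteq> {..<d} \<Longrightarrow> c (q @ inst d b (e i @ w i)) = j"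
    and v: "\<And>t. v t = Some (if t < length q then Letter (q ! t) else
        let s = e (Suc t) ! (t - length q) in if s < d then Letter s else Var (s - d))"
  shows "VWI_solution d c v"
proof -
  have prefix: "\<exists>z. e i' = e i @ z" if "i \<le> i'" for i i'
    using that by (induction i' rule: dec_induct) (auto simp: eS)
  have len: "i \<le> length (e i)" for i
    by (induction i) (auto simp: eS)
  have e_set: "set (e i) \<subseteq> {..<d + i}" for i
    by (induction i) (use w in \<open>fastforce simp: e0 eS\<close>)+
  have e_nth: "e (Suc t) ! t = e i ! t" if "t < length (e i)" for t i
    using prefix[of i "Suc t"] prefix[of "Suc t" i] that len[of "Suc t"]
    by (metis Suc_le_lessD nat_le_linear nth_append)
  \<comment> \<open>\<open>T i\<close> is the place where variable \<open>i\<close> first occurs in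
    \<open>v\<close>.\<close>
  define T where "T i = length q + length (e i) + length (w i)" for i
  have T_mono: "T i < T i'" if "i < i'" for i i'
    using that by (rule lift_Suc_mono_less[rotated]) (simp add: T_def eS)
  have v_e: "v t = Some (let s = e i ! (t - length q) in if s < d then Letter s else Var (s - d))"
    if "length q \<le> t" "t - length q < length (e i)" for t i
  proof -
    have "t - length q < length (e (Suc t))"
      using len[of "Suc t"] by simp
    then have "e (Suc t) ! (t - length q) = e i ! (t - length q)"
      using e_nth[of "t - length q" i] e_nth[of "t - length q" "Suc t"] that(2) by simp
    then show ?thesis using that(1) by (simp add: v)
  qed
  have v_var: "v (T i) = Some (Var i)" for i
    by (subst v_e[of _ "Suc i"]) (auto simp: eS nth_append T_def)
  have v_ew: "v t = Some (let s = (e i @ w i) ! (t - length q) in if s < d then Letter s else Var (s - d))"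
    if "length q \<le> t" "t < T i" for t i
    using that by (subst v_e[of _ "Suc i"]) (auto simp: eS nth_append T_def)
  have ew_set: "(e i @ w i) ! t < d + i" if "t < length (e i @ w i)" for i t
    using that e_set[of i] w[of i] nth_mem[OF that] by auto
  have v_small: "m < i" if "v t = Some (Var m)" "t < T i" for t m i
  proof -
    have "length q \<le> t" using that(1) by (auto simp: v split: if_splits)
    moreover from this have "t - length q < length (e i @ w i)" using that(2) by (simp add: T_def)
    ultimately show ?thesis
      using v_ew[OF _ that(2)] that(1) ew_set[of "t - length q" i] by (auto simp: T_def Let_def split: if_splits)
  qed
  have first: "first_occ v i = T i" for i
    unfolding first_occ_def occurrences_def
    by (rule Least_equality) (use v_var v_small[of _ i i] in \<open>auto simp: not_less[symmetric]\<close>)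
  have vars: "vars v = UNIV"
    using v_var by (auto simp: vars_def occurrences_def)
  have nv: "num_vars v = \<infinity>" by (simp add: num_vars_def vars)
  have ran: "a < d" if "Letter a \<in> ran v" for a
  proof -
    obtain t where t: "v t = Some (Letter a)" using \<open>Letter a \<in> ran v\<close> by (auto simp: ran_def)
    show ?thesis using t words_nth[OF q, of t] by (auto simp: v Let_def split: if_splits)
  qed
  have dom: "dom v = UNIV" by (auto simp: v)
  have vw: "n_variable_word d \<infinity> v"
    unfolding n_variable_word_def variable_word_def
    using ran nv dom first T_mono by (auto intro: exI[of _ \<infinity>])
  have "c (subst v a) = j" if a: "a \<in> words d" for a
  proof -
    \<comment> \<open>The padding value does not matter: only variables below
      \<open>length a\<close> occur before \<open>T (length a)\<close>.\<close>
    define b where "b i = (if i < length a then a ! i else 0)" for i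
    have b: "range b \<subseteq> {..<d}" using words_nth[OF a] d by (auto simp: b_def)
    have sl: "subst_length v a = T (length a)"
      by (simp add: subst_length_def nv vars first)
    have vi: "var_index v m = m" for m
      by (simp add: var_index_def vars)
    have "subst v a = q @ inst d b (e (length a) @ w (length a))"
    proof (rule nth_equalityI)
      show "length (subst v a) = length (q @ inst d b (e (length a) @ w (length a)))"
        by (simp add: subst_def sl T_def)
      fix t assume "t < length (subst v a)"
      then have t: "t < T (length a)" by (simp add: subst_def sl)
      show "subst v a ! t = (q @ inst d b (e (length a) @ w (length a))) ! t"
      proof (cases "t < length q")
        case True
        then show ?thesis using t by (simp add: subst_def sl v subst_symb_def nth_append)
      next
        case False
        let ?s = "(e (length a) @ w (length a)) ! (t - length q)"
        have s: "?s < d + length a" and l: "t - length q < length (e (length a) @ w (length a))"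
          using ew_set[of "t - length q" "length a"] t False by (auto simp: T_def)
        have "subst v a ! t = (if ?s < d then ?s else b (?s - d))"
          using t False s by (auto simp: subst_def sl v_ew subst_symb_def Let_def vi b_def)
        also have "\<dots> = inst d b (e (length a) @ w (length a)) ! (t - length q)"
          using l unfolding inst_def by (simp del: map_append)
        also have "\<dots> = (q @ inst d b (e (length a) @ w (length a))) ! t"
          using False by (simp only: nth_append if_False)
        finally show ?thesis .
      qed
    qed
    then show ?thesis using const[OF b] by simp
  qed
  with vw show ?thesis unfolding VWI_solution_def by blast
qed

text \<open>Replaces the quantifier over assignments of \<open>i\<close> variables by a bounded one
  over numbers, which is decidable.\<close>

lemma digits:
  fixes d :: nat
  assumes "d > 0" "range b \<subseteq> {..<d}"
  shows "\<exists>\<beta><d ^ i. \<forall>l<i. (\<beta> div d ^ l) mod d = b l"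
proof (induction i)
  case (Suc i)
  then obtain \<beta> where \<beta>: "\<beta> < d ^ i" "\<And>l. l < i \<Longrightarrow> (\<beta> div d ^ l) mod d = b l" by blast
  have bi: "b i < d" using assms(2) by auto
  have "\<beta> + b i * d ^ i < d ^ i + b i * d ^ i" using \<beta>(1) by simp
  also have "\<dots> = Suc (b i) * d ^ i" by simp
  also have "\<dots> \<le> d * d ^ i" using bi by (intro mult_right_mono) auto
  finally have 1: "\<beta> + b i * d ^ i < d ^ Suc i" by simp
  have "((\<beta> + b i * d ^ i) div d ^ l) mod d = b l" if "l < Suc i" for l
  proof (cases "l = i")
    case True
    have "(\<beta> + b i * d ^ i) div d ^ i = b i" using \<beta>(1) assms(1) by simp
    then show ?thesis using True bi by simp
  next
    case False
    \<comment> \<open>Below the top digit, \<open>b i * d ^ i\<close> is a multiple of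
      \<open>d ^ l * d\<close> and so leaves digit \<open>l\<close> unchanged.\<close>
    define r where "r = i - Suc l"
    have r: "i = Suc (l + r)" using False that by (simp add: r_def)
    have "\<beta> + b i * d ^ i = \<beta> + (b i * d ^ r * d) * d ^ l" by (simp add: r power_add)
    moreover have "(\<beta> + (b i * d ^ r * d) * d ^ l) div d ^ l = b i * d ^ r * d + \<beta> div d ^ l"
      by (rule div_mult_self1) (use assms(1) in simp)
    ultimately have "(\<beta> + b i * d ^ i) div d ^ l = \<beta> div d ^ l + b i * d ^ r * d"
      by (simp only: add.commute)
    then have "((\<beta> + b i * d ^ i) div d ^ l) mod d = (\<beta> div d ^ l + b i * d ^ r * d) mod d"
      by (rule arg_cong)
    also have "\<dots> = (\<beta> div d ^ l) mod d" by (rule mod_mult_self1)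
    also have "\<dots> = b l" by (rule \<beta>(2)) (simp add: r)
    finally show ?thesis .
  qed
  with 1 show ?case by blast
qed simp

text \<open>
  A state \<open>y\<close> codes a variable word with \<open>i\<close> variables, \<open>x\<close> codes a
  candidate continuation, and \<open>\<beta> < d ^ i\<close> runs through the instantiations via its base-\<open>d\<close> digits.
  The first disjunct makes the search total on meaningless states.
\<close>

definition accepts ::
    "nat \<Rightarrow> (nat \<Rightarrow> nat) \<Rightarrow> nat list \<Rightarrow> nat \<Rightarrow> nat \<Rightarrow> nat \<Rightarrow> nat \<Rightarrow> bool" where
  "accepts d g q j i y x \<longleftrightarrow> \<not> set (list_decode y) \<subseteq> {..<d + i} \<or> set (list_decode x) \<subseteq> {..<d + i} \<and>
     (\<forall>\<beta><d ^ i. g (list_encode (q @ inst d (\<lambda>l. (\<beta> div d ^ l) mod d)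
        (list_decode y @ list_decode x))) = j)"

lemma odec_accepts: "odec g 3 (\<lambda>xs. accepts d g q j (xs ! 1) (xs ! 2) (xs ! 0))"
proof -
  let ?len = "\<lambda>z. length (list_decode z)"
  have sub: "odec g n (\<lambda>xs. set (list_decode (A xs)) \<subseteq> {..<K xs})"
    if "ocomp g n A" "ocomp g n K" for A K n
  proof -
    have "odec g 2 (\<lambda>xs. \<forall>l<?len (xs ! 0). (\<lambda>ys. code_nth (ys ! 1) (ys ! 0) < ys ! 2) (l # xs))"
      by (intro odec_ball odec_less ocomp_nth ocomp_length ocomp_proj) auto
    moreover have "(\<forall>l<?len z. code_nth z l < k) \<longleftrightarrow> set (list_decode z) \<subseteq> {..<k}" for z k
      by (auto simp: subset_iff in_set_conv_nth code_nth_eq)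
    ultimately have "odec g 2 (\<lambda>xs. set (list_decode (xs ! 0)) \<subseteq> {..<xs ! 1})" by simp
    from ocomp_comp2[where h = "\<lambda>x k. if set (list_decode x) \<subseteq> {..<k} then 0 else 1",
        OF this[unfolded odec_def] that]
    show ?thesis unfolding odec_def .
  qed
  let ?sv = "\<lambda>\<beta> s. if s < d then s else (\<beta> div d ^ (s - d)) mod d"
  have "ocomp g 2 (\<lambda>xs. ?sv (xs ! 0) (xs ! 1))"
    by (intro ocomp_if odec_less ocomp_mod ocomp_div ocomp_power ocomp_diff ocomp_const ocomp_proj) auto
  note sv = ocomp_comp2[where h = ?sv, OF this]
  let ?lq = "length q"
  \<comment> \<open>The arguments \<open>ys\<close> are the position in the word,
    \<open>\<beta>\<close>, \<open>x\<close>, \<open>i\<close> and \<open>y\<close>, in this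
    order.\<close>
  let ?F = "\<lambda>ys. if ys ! 0 < ?lq then code_nth (list_encode q) (ys ! 0)
    else ?sv (ys ! 1) (code_nth (list_encode (list_decode (ys ! 4) @ list_decode (ys ! 2))) (ys ! 0 - ?lq))"
  have "ocomp g 4 (\<lambda>xs. list_encode (map (\<lambda>t. ?F (t # xs)) [0..<?lq + ?len (xs ! 3) + ?len (xs ! 1)]))"
    by (intro ocomp_tabulate ocomp_if odec_less sv ocomp_nth ocomp_append ocomp_length ocomp_diff
        ocomp_add ocomp_const ocomp_proj) auto
  moreover have "map (\<lambda>t. ?F (t # xs)) [0..<?lq + ?len (xs ! 3) + ?len (xs ! 1)]
      = q @ inst d (\<lambda>l. (xs ! 0 div d ^ l) mod d) (list_decode (xs ! 3) @ list_decode (xs ! 1))" for xs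
    by (rule nth_equalityI) (auto simp: code_nth_eq nth_append inst_def numeral_eq_Suc)
  ultimately have word: "ocomp g 4 (\<lambda>xs. list_encode (q @ inst d (\<lambda>l. (xs ! 0 div d ^ l) mod d)
      (list_decode (xs ! 3) @ list_decode (xs ! 1))))" by simp
  have "odec g 3 (\<lambda>xs. \<forall>\<beta><d ^ (xs ! 1). (\<lambda>xs. g (list_encode (q @ inst d
      (\<lambda>l. (xs ! 0 div d ^ l) mod d) (list_decode (xs ! 3) @ list_decode (xs ! 1)))) = j) (\<beta> # xs))"
    by (intro odec_ball odec_eq ocomp_oracle ocomp_power ocomp_const ocomp_proj) (use word in auto)
  then have ball: "odec g 3 (\<lambda>xs. \<forall>\<beta><d ^ (xs ! 1). g (list_encode (q @ inst d
      (\<lambda>l. (\<beta> div d ^ l) mod d) (list_decode (xs ! 2) @ list_decode (xs ! 0)))) = j)"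
    by (simp add: numeral_eq_Suc)
  show ?thesis
    unfolding accepts_def
    by (intro odec_or odec_and odec_not sub ball ocomp_add ocomp_const ocomp_proj) auto
qed

text \<open>Each search halts because \<open>q\<close> is extensible; appending the new variable
  \<open>d + i\<close> after each continuation found yields the chain of
  \<open>chain_solution\<close>, computed from \<open>c\<close>.\<close>

lemma extensible_imp_computable_solution:
  assumes d: "d > 0" and q: "q \<in> words d" and ext: "extensible d c q j"
  shows "\<exists>v. VWI_solution d c v \<and> coloring_computable d c v"
proof -
  define g where "g = coloring_oracle d c"
  have g: "g (list_encode u) = c u" if "u \<in> words d" for u
    using that by (simp add: g_def coloring_oracle_def)
  define next' where "next' i y = (LEAST x. accepts d g q j i y x)" for i y
  \<comment> \<open>\<open>Suc (prod_encode (d + i, 0))\<close> codes the one-element list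
    \<open>[d + i]\<close>.\<close>
  define state where "state = rec_nat 0 (\<lambda>i y. list_encode
    (list_decode (list_encode (list_decode y @ list_decode (next' i y))) @
     list_decode (Suc (prod_encode (d + i, 0)))))"
  have digit: "range (\<lambda>l. (\<beta> div d ^ l) mod d) \<subseteq> {..<d}" for \<beta> using d by auto
  have ex: "\<exists>x. accepts d g q j i y x" for i y
  proof (cases "set (list_decode y) \<subseteq> {..<d + i}")
    case True
    obtain w where "set w \<subseteq> {..<d + i}"
      "\<And>b. range b \<subseteq> {..<d} \<Longrightarrow> c (q @ inst d b (list_decode y @ w)) = j"
      using ext True unfolding extensible_def by blast
    then have "accepts d g q j i y (list_encode w)"
      using digit q by (auto simp: accepts_def g inst_in_words simp del: inst_append)
    then show ?thesis ..
  qed (simp add: accepts_def)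
  have next_acc: "accepts d g q j i y (next' i y)" for i y
    unfolding next'_def using ex by (rule LeastI_ex)
  have "ocomp g 2 (\<lambda>xs. LEAST x. (\<lambda>ys. accepts d g q j (ys ! 1) (ys ! 2) (ys ! 0)) (x # xs))"
    by (rule ocomp_Least) (use odec_accepts[of g d q j] ex in \<open>simp_all add: numeral_eq_Suc\<close>)
  then have "ocomp g 2 (\<lambda>xs. next' (xs ! 0) (xs ! 1))"
    by (simp add: next'_def numeral_eq_Suc)
  note next_comp = ocomp_comp2[where h = next', OF this]
  have "ocomp g 1 (\<lambda>xs. rec_nat 0 (\<lambda>i y. (\<lambda>ys. list_encode
    (list_decode (list_encode (list_decode (ys ! 1) @ list_decode (next' (ys ! 0) (ys ! 1)))) @
     list_decode (Suc (prod_encode (d + ys ! 0, 0))))) (i # y # xs)) (xs ! 0))"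
    by (intro ocomp_rec ocomp_append next_comp ocomp_Suc ocomp_prod_encode ocomp_add ocomp_const ocomp_proj) auto
  then have "ocomp g 1 (\<lambda>xs. state (xs ! 0))"
    by (simp add: state_def)
  note state_comp = ocomp_comp1[where h = state, OF this]
  define e where "e i = list_decode (state i)" for i
  define w where "w i = list_decode (next' i (state i))" for i
  have e0: "e 0 = []" by (simp add: e_def state_def)
  have eS: "e (Suc i) = e i @ w i @ [d + i]" for i
    by (simp add: e_def w_def state_def)
  have e_set: "set (e i) \<subseteq> {..<d + i}" for i
  proof (induction i)
    case (Suc i)
    then have "set (w i) \<subseteq> {..<d + i}"
      using next_acc[of i "state i"] by (simp add: accepts_def e_def w_def)
    with Suc show ?case by (fastforce simp: eS)
  qed (simp add: e0)
  have w_set: "set (w i) \<subseteq> {..<d + i}"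
    and w_acc: "\<And>\<beta>. \<beta> < d ^ i \<Longrightarrow>
      g (list_encode (q @ inst d (\<lambda>l. (\<beta> div d ^ l) mod d) (e i @ w i))) = j" for i
    using next_acc[of i "state i"] e_set[of i] by (auto simp: accepts_def e_def w_def)
  have const: "c (q @ inst d b (e i @ w i)) = j" if b: "range b \<subseteq> {..<d}" for b i
  proof -
    obtain \<beta> where \<beta>: "\<beta> < d ^ i" "\<And>l. l < i \<Longrightarrow> (\<beta> div d ^ l) mod d = b l"
      using digits[OF d b] by blast
    have "inst d (\<lambda>l. (\<beta> div d ^ l) mod d) (e i @ w i) = inst d b (e i @ w i)"
      by (rule inst_cong[of _ _ i]) (use e_set[of i] w_set[of i] \<beta>(2) in auto)
    then show ?thesis
      using w_acc[OF \<beta>(1)] g q inst_in_words[OF b] by (simp del: inst_append)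
  qed
  define v where "v t = Some (if t < length q then Letter (q ! t) else
    let s = e (Suc t) ! (t - length q) in if s < d then Letter s else Var (s - d))" for t
  have "VWI_solution d c v"
    by (rule chain_solution[where e = e and w = w and d = d and q = q and c = c and j = j, OF e0 eS w_set q d const v_def])
  moreover have "coloring_computable d c v"
  proof -
    \<comment> \<open>This spells out \<open>symb_encode\<close>, with even codes for letters and
      odd ones for variables, reading behind \<open>q\<close> from
      \<open>state (Suc t)\<close>.\<close>
    have "ocomp g 1 (\<lambda>xs. if xs ! 0 < length q then 2 * code_nth (list_encode q) (xs ! 0)
      else if code_nth (state (Suc (xs ! 0))) (xs ! 0 - length q) < d
        then 2 * code_nth (state (Suc (xs ! 0))) (xs ! 0 - length q)
        else 2 * (code_nth (state (Suc (xs ! 0))) (xs ! 0 - length q) - d) + 1)"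
      by (intro ocomp_if odec_less ocomp_mult ocomp_nth state_comp ocomp_Suc ocomp_diff ocomp_add
          ocomp_const ocomp_proj) auto
    from ocomp_computable_in[where f = "\<lambda>t. if t < length q then 2 * code_nth (list_encode q) t
      else if code_nth (state (Suc t)) (t - length q) < d
        then 2 * code_nth (state (Suc t)) (t - length q)
        else 2 * (code_nth (state (Suc t)) (t - length q) - d) + 1", OF this]
    have "computable_in g (\<lambda>t. if t < length q then 2 * code_nth (list_encode q) t
      else if code_nth (state (Suc t)) (t - length q) < d
        then 2 * code_nth (state (Suc t)) (t - length q)
        else 2 * (code_nth (state (Suc t)) (t - length q) - d) + 1)" .
    moreover have "symb_encode (the (v t)) = (if t < length q then 2 * code_nth (list_encode q) t
      else if code_nth (state (Suc t)) (t - length q) < d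
        then 2 * code_nth (state (Suc t)) (t - length q)
        else 2 * (code_nth (state (Suc t)) (t - length q) - d) + 1)" for t
    proof -
      have "i \<le> length (e i)" for i by (induction i) (auto simp: eS)
      then have "t - length q < length (list_decode (state (Suc t)))"
        unfolding e_def by (meson diff_le_self le_imp_less_Suc less_le_trans)
      then show ?thesis by (simp add: v_def code_nth_eq e_def Let_def)
    qed
    ultimately show ?thesis
      unfolding coloring_computable_def g_def by (auto simp: v_def)
  qed
  ultimately show ?thesis by blast
qed

section \<open>A sequence in ENSH from a coloring without computable solution\<close>

text \<open>A word \<open>e\<close> over \<open>m\<close> variables with this property witnesses
  that \<open>q\<close> is not extensible for \<open>j\<close>.\<close>

definition avoids :: "nat \<Rightarrow> (nat list \<Rightarrow> nat) \<Rightarrow> nat list \<Rightarrow> nat \<Rightarrow> nat list \<Rightarrow> nat \<Rightarrow> bool" where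
  "avoids d c q m e j \<longleftrightarrow> (\<forall>w. set w \<subseteq> {..<d + m} \<longrightarrow>
     (\<exists>b. range b \<subseteq> {..<d} \<and> c (q @ inst d b (e @ w)) \<noteq> j))"

text \<open>Setting the new variables to the letter \<open>0\<close> turns \<open>z @ w\<close> into
  a continuation \<open>w0\<close> over the old variables; the assignment that defeats
  \<open>w0\<close> then extends by \<open>0\<close>.\<close>

lemma avoids_mono:
  assumes "avoids d c q m e j" "set e \<subseteq> {..<d + m}" "m \<le> m'" "set z \<subseteq> {..<d + m'}" "d > 0"
  shows "avoids d c q m' (e @ z) j"
  unfolding avoids_def
proof (intro allI impI)
  fix w assume w: "set w \<subseteq> {..<d + m'}"
  define w0 where "w0 = map (\<lambda>s. if s < d + m then s else 0) (z @ w)"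
  have "set w0 \<subseteq> {..<d + m}" using assms(5) by (auto simp: w0_def)
  then obtain b where b: "range b \<subseteq> {..<d}" "c (q @ inst d b (e @ w0)) \<noteq> j"
    using assms(1) unfolding avoids_def by blast
  define b' where "b' i = (if i < m then b i else 0)" for i
  have "range b' \<subseteq> {..<d}" using b(1) assms(5) by (auto simp: b'_def)
  moreover have "inst d b e = inst d b' e"
    by (rule inst_cong[OF assms(2)]) (simp add: b'_def)
  moreover have "inst d b w0 = inst d b' (z @ w)"
    using assms(5) by (auto simp: inst_def w0_def b'_def)
  ultimately show "\<exists>b. range b \<subseteq> {..<d} \<and> c (q @ inst d b ((e @ z) @ w)) \<noteq> j"
    using b(2) by (intro exI[of _ b']) simp
qed

text \<open>With its variables set to \<open>0\<close>, \<open>e\<close> becomes part of the fixed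
  word, behind which some \<open>e2\<close> witnesses non-extensibility. Shifting the variables of
  \<open>e2\<close> by \<open>m\<close> separates them from those of \<open>e\<close>; assignments
  that are \<open>0\<close> on the first \<open>m\<close> variables then defeat every
  continuation.\<close>

lemma not_extensible_avoids:
  assumes "\<not> extensible d c (q @ inst d (\<lambda>_. 0) e) j" "set e \<subseteq> {..<d + m}" "d > 0"
  shows "\<exists>m' z. m \<le> m' \<and> set z \<subseteq> {..<d + m'} \<and> avoids d c q m' (e @ z) j"
proof -
  obtain m2 e2 where e2: "set e2 \<subseteq> {..<d + m2}"
    and ne: "\<And>w. set w \<subseteq> {..<d + m2} \<Longrightarrow>
      \<exists>b. range b \<subseteq> {..<d} \<and> c ((q @ inst d (\<lambda>_. 0) e) @ inst d b (e2 @ w)) \<noteq> j"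
    using assms(1) unfolding extensible_def by meson
  define z where "z = map (\<lambda>s. if s < d then s else s + m) e2"
  have "avoids d c q (m + m2) (e @ z) j"
    unfolding avoids_def
  proof (intro allI impI)
    fix w assume w: "set w \<subseteq> {..<d + (m + m2)}"
    define w2 where "w2 = map (\<lambda>s. if s < d then s else if s < d + m then 0 else s - m) w"
    have "set w2 \<subseteq> {..<d + m2}" using w assms(3) by (auto simp: w2_def)
    then obtain b where b: "range b \<subseteq> {..<d}"
      "c ((q @ inst d (\<lambda>_. 0) e) @ inst d b (e2 @ w2)) \<noteq> j"
      using ne[of w2] by meson
    define b' where "b' i = (if i < m then 0 else b (i - m))" for i
    have "range b' \<subseteq> {..<d}" using b(1) assms(3) by (auto simp: b'_def)
    moreover have "inst d (\<lambda>_. 0) e = inst d b' e"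
      by (rule inst_cong[OF assms(2)]) (simp add: b'_def)
    moreover have "inst d b e2 = inst d b' z"
      by (auto simp: inst_def z_def b'_def)
    moreover have "inst d b w2 = inst d b' w"
    proof -
      have "s - m - d = s - d - m" for s by simp
      then show ?thesis using assms(3) by (auto simp: inst_def w2_def b'_def)
    qed
    ultimately show "\<exists>b. range b \<subseteq> {..<d} \<and> c (q @ inst d b ((e @ z) @ w)) \<noteq> j"
      using b(2) by (intro exI[of _ b']) simp
  qed
  moreover have "set z \<subseteq> {..<d + (m + m2)}" using e2 by (auto simp: z_def)
  ultimately show ?thesis by (intro exI[of _ "m + m2"] exI[of _ z]) simp
qed

text \<open>The pairs are treated one after the other; \<open>avoids_mono\<close> protects those
  already done.\<close>

lemma avoids_all:
  assumes "finite P" "\<And>q j. (q, j) \<in> P \<Longrightarrow> q \<in> words d"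
    "\<And>q j. q \<in> words d \<Longrightarrow> \<not> extensible d c q j" "d > 0"
  shows "\<exists>m>0. \<exists>e. set e \<subseteq> {..<d + m} \<and> (\<forall>(q, j)\<in>P. avoids d c q m e j)"
  using assms(1,2)
proof (induction P rule: finite_induct)
  case empty
  \<comment> \<open>One variable is provided from the start, since \<open>m\<close> will become a
    block size and must be positive.\<close>
  show ?case by (intro exI[of _ "1::nat"] conjI exI[of _ "[]"]) simp_all
next
  case (insert x P)
  obtain q j where x: "x = (q, j)" by (cases x)
  obtain m e where m: "m > 0" "set e \<subseteq> {..<d + m}" "\<forall>(q, j)\<in>P. avoids d c q m e j"
    using insert by auto
  have "q \<in> words d" using insert.prems x by auto
  then have "\<not> extensible d c (q @ inst d (\<lambda>_. 0) e) j"
    using assms(4) by (intro assms(3)) (auto intro: inst_in_words)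
  then obtain m' z where z: "m \<le> m'" "set z \<subseteq> {..<d + m'}" "avoids d c q m' (e @ z) j"
    using not_extensible_avoids m(2) assms(4) by blast
  then have "\<forall>(q, j)\<in>insert x P. avoids d c q m' (e @ z) j"
    using m x avoids_mono assms(4) by blast
  moreover have "set (e @ z) \<subseteq> {..<d + m'}" using m(2) z by auto
  ultimately show ?case using m(1) z(1) by (intro exI[of _ m'] conjI exI[of _ "e @ z"]) auto
qed

section \<open>Finite word sets and first occurrences in variable words\<close>

lemma finite_words_of_length: "finite (words_of_length d n)"
  using finite_lists_length_eq[of "{..<d}" n]
  by (simp add: words_of_length_def words_def lists_eq_set Collect_conj_eq[symmetric])

lemma first_occ_in: "m \<in> vars v \<Longrightarrow> v (first_occ v m) = Some (Var m)"
  unfolding vars_def first_occ_def occurrences_def by (auto intro: LeastI)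

lemma first_occ_le: "v t = Some (Var m) \<Longrightarrow> m \<in> vars v \<and> first_occ v m \<le> t"
  unfolding vars_def first_occ_def occurrences_def by (auto intro: Least_le)

text \<open>First occurrences increase with the index and fill the section, so the variable first
  occurring at \<open>st + i\<close> has index \<open>i\<close>. This turns the word into a list
  \<open>\<sigma>\<close> of numeric symbols.\<close>

lemma section_word:
  assumes v: "n_variable_word d (enat n) v" and dom: "dom v = {..<N}"
    and sec: "first_occ v ` vars v = {st..<st + n}"
  obtains \<sigma> where "\<And>t. t < N \<Longrightarrow> \<sigma> t < d + n" "\<And>t. t < N \<Longrightarrow> t < st \<Longrightarrow> \<sigma> t < d"
    "\<And>i. i < n \<Longrightarrow> \<sigma> (st + i) = d + i"
    "\<And>b. length b = n \<Longrightarrow> subst v b = inst d ((!) b) (map \<sigma> [0..<N])"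
proof -
  define \<sigma> where "\<sigma> t = (case the (v t) of Letter a \<Rightarrow> a | Var x \<Rightarrow> d + var_index v x)" for t
  have fin: "finite (vars v)" and card: "card (vars v) = n" and nv: "num_vars v = enat n"
    using v by (auto simp: n_variable_word_def num_vars_def split: if_splits)
  have mono: "first_occ v x < first_occ v y" if "x \<in> vars v" "y \<in> vars v" "x < y" for x y
    using v that by (simp add: n_variable_word_def)
  have mono_iff: "first_occ v x < first_occ v y \<longleftrightarrow> x < y" if "x \<in> vars v" "y \<in> vars v" for x y
    using mono[OF that] mono[OF that(2,1)] by (cases x y rule: linorder_cases) auto
  have vi: "st + var_index v x = first_occ v x \<and> first_occ v x < st + n" if x: "x \<in> vars v" for x
  proof -
    have range: "first_occ v x \<in> {st..<st + n}" using sec x by blast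
    \<comment> \<open>The variables before \<open>x\<close> are counted by their first occurrences,
      which fill the section up to that of \<open>x\<close>.\<close>
    have "first_occ v ` {y \<in> vars v. y < x} = {st..<first_occ v x}"
    proof (intro equalityI subsetI)
      fix t assume t: "t \<in> {st..<first_occ v x}"
      then have "t \<in> first_occ v ` vars v" using sec range by auto
      then show "t \<in> first_occ v ` {y \<in> vars v. y < x}" using mono_iff[OF _ x] t by auto
    qed (use sec mono_iff x in auto)
    moreover have "inj_on (first_occ v) {y \<in> vars v. y < x}"
      by (rule linorder_inj_onI) (auto simp: mono_iff dest: mono)
    ultimately have "var_index v x = first_occ v x - st"
      unfolding var_index_def by (metis card_atLeastLessThan card_image)
    then show ?thesis using range by auto
  qed
  have letter: "a < d" if "v t = Some (Letter a)" for t a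
    using v that by (auto simp: n_variable_word_def variable_word_def ran_def)
  have dom': "v t \<noteq> None" if "t < N" for t using dom that by auto
  have occ: "x \<in> vars v" "first_occ v x \<le> t" if "v t = Some (Var x)" for t x
    using first_occ_le[of v t x] that by auto
  show ?thesis
  proof (rule that)
    fix t assume t: "t < N"
    show "\<sigma> t < d + n"
      using dom'[OF t] letter[of t] vi occ by (fastforce simp: \<sigma>_def split: symb.split)
    assume "t < st"
    then show "\<sigma> t < d"
      using dom'[OF t] letter[of t] vi occ by (fastforce simp: \<sigma>_def split: symb.split)
  next
    fix i assume i: "i < n"
    then have "st + i \<in> first_occ v ` vars v" using sec by auto
    then obtain x where x: "x \<in> vars v" "first_occ v x = st + i" by auto
    then show "\<sigma> (st + i) = d + i"
      using first_occ_in[OF x(1)] vi[OF x(1)] by (simp add: \<sigma>_def)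
  next
    fix b :: "nat list" assume b: "length b = n"
    have "subst_symb v b (the (v t)) = (if \<sigma> t < d then \<sigma> t else b ! (\<sigma> t - d))" if "t < N" for t
      using dom'[OF that] letter[of t] by (auto simp: \<sigma>_def subst_symb_def split: symb.split)
    then show "subst v b = inst d ((!) b) (map \<sigma> [0..<N])"
      by (simp add: subst_def subst_length_def b nv dom inst_def)
  qed
qed

text \<open>Stage \<open>s\<close> appends a word that avoids all colors below \<open>k\<close>
  behind every word of the length \<open>len s\<close> reached so far; its variables form section
  \<open>s\<close>. A homogeneous section would yield a fixed word before stage \<open>s\<close> and
  only variables of section \<open>s\<close> after it, which avoidance excludes.\<close>

lemma no_computable_solution_imp_ENSH_sequence:
  assumes d: "d > 0" and c: "VWI_instance d k c"
    and no: "\<not> (\<exists>v. VWI_solution d c v \<and> coloring_computable d c v)"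
  shows "\<exists>X. X \<in> ENSH_sequences d k"
proof -
  have ne: "\<not> extensible d c q j" if "q \<in> words d" for q j
    using extensible_imp_computable_solution[OF d that] no by blast
  let ?Q = "\<lambda>l p. fst p > 0 \<and> set (snd p) \<subseteq> {..<d + fst p} \<and>
      (\<forall>(q, j)\<in>words_of_length d l \<times> {..<k}. avoids d c q (fst p) (snd p) j)"
  have "\<exists>p. ?Q l p" for l
  proof -
    have fin: "finite (words_of_length d l \<times> {..<k})" using finite_words_of_length by simp
    have sub: "q \<in> words d" if "(q, j) \<in> words_of_length d l \<times> {..<k}" for q j
      using that by (simp add: words_of_length_def)
    have "\<exists>m>0. \<exists>e. set e \<subseteq> {..<d + m} \<and>
        (\<forall>(q, j)\<in>words_of_length d l \<times> {..<k}. avoids d c q m e j)"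
      by (rule avoids_all) (rule fin, erule sub, erule ne, rule d)
    then obtain m e where "m > 0" "set e \<subseteq> {..<d + m}"
      "\<forall>(q, j)\<in>words_of_length d l \<times> {..<k}. avoids d c q m e j"
      by (elim exE conjE)
    then show ?thesis by (intro exI[of _ "(m, e)"]) simp
  qed
  then have "\<forall>l. \<exists>p. ?Q l p" by (rule allI)
  from choice[OF this] obtain p where p: "\<forall>l. ?Q l (p l)" by (elim exE)
  define m where "m l = fst (p l)" for l
  define e where "e l = snd (p l)" for l
  have m: "m l > 0" and e: "set (e l) \<subseteq> {..<d + m l}" for l
    using p by (simp_all add: m_def e_def)
  have av: "avoids d c q (m l) (e l) j" if "q \<in> words_of_length d l" "j < k" for l q j
    using spec[OF p, of l] that by (auto simp: m_def e_def)
  \<comment> \<open>All instances of the first \<open>s\<close> appended words together have length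
    \<open>len s\<close>, so treating every word of that length covers them.\<close>
  define len where "len = rec_nat 0 (\<lambda>_ l. l + length (e l))"
  define X where "X s = m (len s)" for s
  define start where "start s = sum_list (map X [0..<s])" for s
  have start_Suc: "start (Suc s) = start s + X s" for s by (simp add: start_def)
  have start_mono: "start s \<le> start s'" if "s \<le> s'" for s s'
    using that by (induction s' rule: dec_induct) (auto simp: start_Suc)
  define block where "block s a = inst d (\<lambda>i. a ! (start s + i)) (e (len s))" for s a
  define U where "U = rec_nat (\<lambda>_. []) (\<lambda>s u a. u a @ block s a)"
  have U_0: "U 0 a = []" and U_Suc: "U (Suc s) a = U s a @ block s a" for s a
    by (simp_all add: U_def)
  have U_length: "length (U s a) = len s" for s a
    by (induction s) (auto simp: U_0 U_Suc block_def len_def)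
  have block_words: "block s a \<in> words d" if "a \<in> words d" "start (Suc s) \<le> length a" for s a
  proof -
    let ?b = "\<lambda>i. if start s + i < length a then a ! (start s + i) else 0"
    have "block s a = inst d ?b (e (len s))"
      unfolding block_def by (rule inst_cong[OF e]) (use that in \<open>auto simp: start_Suc X_def\<close>)
    also have "\<dots> \<in> words d" by (rule inst_in_words) (use words_nth[OF that(1)] d in auto)
    finally show ?thesis .
  qed
  have U_words: "U s a \<in> words d" if "a \<in> words d" "start s \<le> length a" for s a
    using that(2)
  proof (induction s)
    case 0
    then show ?case by (simp add: U_0 words_def)
  next
    case (Suc s)
    then show ?case using block_words[OF that(1) Suc.prems] by (simp add: U_Suc start_Suc)
  qed
  have "ENSH d k (map X [0..<r])" for r
    unfolding ENSH_def
  proof (intro exI conjI)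
    show "(\<lambda>a. c (U r a)) \<in> words_of_length d (sum_list (map X [0..<r])) \<rightarrow> {..<k}"
      using c U_words[of _ r] by (auto simp: VWI_instance_def words_of_length_def start_def[symmetric])
    show "\<not> sectionally_homogeneous d (map X [0..<r]) (\<lambda>a. c (U r a))"
    proof
      assume "sectionally_homogeneous d (map X [0..<r]) (\<lambda>a. c (U r a))"
      then obtain s v j where s: "s < r" and v: "n_variable_word d (enat (X s)) v"
        and dom: "dom v = {..<start r}"
        and sec: "first_occ v ` vars v = {start s..<start s + X s}"
        and hom: "\<And>a. a \<in> words_of_length d (X s) \<Longrightarrow> c (U r (subst v a)) = j"
        unfolding sectionally_homogeneous_def section_positions_def
        by (auto simp: take_map start_def)
      obtain \<sigma> where \<sigma>: "\<And>t. t < start r \<Longrightarrow> \<sigma> t < d + X s"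
        "\<And>t. t < start r \<Longrightarrow> t < start s \<Longrightarrow> \<sigma> t < d"
        "\<And>i. i < X s \<Longrightarrow> \<sigma> (start s + i) = d + i"
        "\<And>b. length b = X s \<Longrightarrow> subst v b = inst d ((!) b) (map \<sigma> [0..<start r])"
        using section_word[OF v dom sec] by metis
      define A where "A b = inst d b (map \<sigma> [0..<start r])" for b
      have A_nth: "A b ! t = (if \<sigma> t < d then \<sigma> t else b (\<sigma> t - d))" if "t < start r" for b t
        using that by (simp add: A_def inst_def)
      have A_words: "A b \<in> words_of_length d (start r)" if "range b \<subseteq> {..<d}" for b
        using that by (simp add: A_def words_of_length_def inst_in_words)
      \<comment> \<open>Positions before section \<open>s\<close> carry letters, so the first
        \<open>s\<close> blocks do not depend on \<open>b\<close>.\<close>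
      have before: "U s' (A b) = U s' (A b')" if "s' \<le> s" for s' b b'
        using that
      proof (induction s')
        case (Suc s')
        have "block s' (A b) = block s' (A b')"
          unfolding block_def
        proof (rule inst_cong[OF e])
          fix i assume "i < m (len s')"
          then have "start s' + i < start s"
            using start_mono[OF Suc.prems] by (simp add: start_Suc X_def)
          then show "A b ! (start s' + i) = A b' ! (start s' + i)"
            using \<sigma>(2)[of "start s' + i"] start_mono[of s r] s by (simp add: A_nth)
        qed
        with Suc show ?case by (simp add: U_Suc)
      qed (simp add: U_0)
      \<comment> \<open>Block \<open>s\<close> is an instance of \<open>e (len s)\<close> itself; in
        later blocks the entries of \<open>\<sigma>\<close> replace the variables, giving words over
        the variables of section \<open>s\<close> only.\<close>
      have after: "\<exists>w. set w \<subseteq> {..<d + X s} \<and>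
          (\<forall>b. U r' (A b) = U s (A b) @ inst d b (e (len s) @ w))" if "Suc s \<le> r'" "r' \<le> r" for r'
        using that
      proof (induction r' rule: dec_induct)
        case base
        have "block s (A b) = inst d b (e (len s))" for b
          unfolding block_def
        proof (rule inst_cong[OF e])
          fix i assume "i < m (len s)"
          then have "i < X s" by (simp add: X_def)
          moreover from this have "start s + i < start r"
            using start_mono[of "Suc s" r] s by (simp add: start_Suc)
          ultimately show "A b ! (start s + i) = b i"
            using \<sigma>(3) by (simp add: A_nth)
        qed
        then show ?case by (intro exI[of _ "[]"]) (simp add: U_Suc inst_def)
      next
        case (step r')
        then obtain w where w: "set w \<subseteq> {..<d + X s}"
          "\<And>b. U r' (A b) = U s (A b) @ inst d b (e (len s) @ w)" by auto
        let ?z = "map (\<lambda>x. if x < d then x else \<sigma> (start r' + (x - d))) (e (len r'))"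
        have pos: "start r' + (x - d) < start r" if "x \<in> set (e (len r'))" "\<not> x < d" for x
          using that e[of "len r'"] start_mono[OF step.prems]
          by (fastforce simp: start_Suc X_def)
        have "set ?z \<subseteq> {..<d + X s}" using \<sigma>(1) pos by auto
        moreover have "block r' (A b) = inst d b ?z" for b
          unfolding block_def inst_def using pos by (auto simp: A_nth)
        ultimately show ?case
          using w by (intro exI[of _ "w @ ?z"]) (auto simp: U_Suc)
      qed
      obtain w where w: "set w \<subseteq> {..<d + X s}"
        "\<And>b. U r (A b) = U s (A b) @ inst d b (e (len s) @ w)"
        using after[of r] s by auto
      define q where "q = U s (A (\<lambda>_. 0))"
      have hom': "c (q @ inst d b (e (len s) @ w)) = j" if b: "range b \<subseteq> {..<d}" for b
      proof -
        let ?b = "map b [0..<X s]"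
        have "subst v ?b = A b"
          unfolding A_def \<sigma>(4)[of ?b, simplified]
          by (rule inst_cong[of _ _ "X s"]) (use \<sigma>(1) in auto)
        moreover have "?b \<in> words_of_length d (X s)"
          using range_subsetD[OF b] by (auto simp: words_of_length_def words_def)
        ultimately show ?thesis
          using hom[of ?b] w(2)[of b] before[of s b "\<lambda>_. 0"] by (simp add: q_def)
      qed
      have q: "q \<in> words_of_length d (len s)"
        using U_words[of "A (\<lambda>_. 0)" s] A_words[of "\<lambda>_. 0"] start_mono[of s r] s d
        by (auto simp: q_def words_of_length_def U_length)
      have z: "range (\<lambda>_. 0) \<subseteq> {..<d}" using d by auto
      \<comment> \<open>Avoidance was arranged only for colors below \<open>k\<close>, so
        \<open>j\<close> has to be shown to be one.\<close>
      have "q @ inst d (\<lambda>_. 0) (e (len s) @ w) \<in> words d"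
        using q inst_in_words[OF z] by (simp add: words_of_length_def del: inst_append)
      then have "j < k" using hom'[OF z] c by (auto simp: VWI_instance_def)
      from av[OF q this] w(1) obtain b where "range b \<subseteq> {..<d}"
        "c (q @ inst d b (e (len s) @ w)) \<noteq> j"
        unfolding avoids_def X_def by meson
      with hom' show False by meson
    qed
  qed
  moreover have "X s > 0" for s using m by (simp add: X_def)
  ultimately show ?thesis unfolding ENSH_sequences_def by (intro exI[of _ X]) simp
qed

section \<open>Use and determinism of oracle computations\<close>

instance oprog :: countable by countable_datatype

lemma oeval_deterministic: "oeval g p xs y \<Longrightarrow> oeval g p xs y' \<Longrightarrow> y = y'"
proof (induction arbitrary: y' rule: oeval.induct)
  case (oeval_Comp ys qs xs p z)
  from oeval_Comp.prems obtain ys' where ys': "length ys' = length qs"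
    "\<forall>i<length qs. oeval g (qs ! i) xs (ys' ! i)" "oeval g p ys' y'"
    by (auto elim: oeval.cases)
  have "ys = ys'" using oeval_Comp ys' by (auto intro!: nth_equalityI)
  then show ?case using oeval_Comp.IH ys'(3) by blast
next
  case (oeval_Prec_0 p xs z q)
  from oeval_Prec_0.prems have "oeval g p xs y'" by (auto elim: oeval.cases)
  then show ?case by (rule oeval_Prec_0.IH)
next
  case (oeval_Prec_Suc p q n xs y z)
  from oeval_Prec_Suc.prems obtain y1 where "oeval g (Prec p q) (n # xs) y1"
    "oeval g q (n # y1 # xs) y'" by (auto elim: oeval.cases)
  then show ?case using oeval_Prec_Suc.IH by blast
next
  case (oeval_Mu p n xs)
  from oeval_Mu.prems have y': "oeval g p (y' # xs) 0" "\<forall>i<y'. \<exists>y>0. oeval g p (i # xs) y"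
    by (auto elim: oeval.cases)
  \<comment> \<open>Were the two results different, \<open>p\<close> would have both the output
    \<open>0\<close> and a positive output at the smaller one.\<close>
  show ?case
  proof (rule linorder_cases[of n y'])
    assume "n < y'"
    then obtain y where "y > 0" "oeval g p (n # xs) y" using y'(2) by blast
    then show ?thesis using oeval_Mu.IH(1)[of y] by simp
  next
    assume "y' < n"
    then obtain y where "y > 0" "\<forall>z. oeval g p (y' # xs) z \<longrightarrow> y = z"
      using oeval_Mu.IH(2) by blast
    then show ?thesis using y'(1) by auto
  qed
qed (auto elim: oeval.cases)

lemma bounded_uniform:
  fixes Q :: "nat \<Rightarrow> nat \<Rightarrow> bool"
  assumes "\<And>i. i < n \<Longrightarrow> \<exists>K. Q K i" "\<And>K K' i. Q K i \<Longrightarrow> K \<le> K' \<Longrightarrow> Q K' i"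
  shows "\<exists>K. \<forall>i<n. Q K i"
  using assms(1)
proof (induction n)
  case (Suc n)
  then obtain K K' where "\<forall>i<n. Q K i" "Q K' n" by (meson less_Suc_eq)
  then have "\<forall>i<Suc n. Q (max K K') i"
    using assms(2) by (metis less_Suc_eq max.cobounded1 max.cobounded2)
  then show ?case ..
qed simp

text \<open>The use principle: a halting computation asks finitely many oracle questions, and the
  bounds for its subcomputations combine by maximum.\<close>

lemma oeval_use:
  "oeval g p xs y \<Longrightarrow> \<exists>K. \<forall>g'. (\<forall>x<K. g' x = g x) \<longrightarrow> oeval g' p xs y"
proof (induction rule: oeval.induct)
  case (oeval_Oracle x)
  show ?case by (intro exI[of _ "Suc x"]) (metis lessI oeval.oeval_Oracle)
next
  case (oeval_Comp ys qs xs p z)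
  have "\<exists>K. \<forall>i<length qs. \<forall>g'. (\<forall>x<K. g' x = g x) \<longrightarrow> oeval g' (qs ! i) xs (ys ! i)"
    by (rule bounded_uniform) (use oeval_Comp.IH in \<open>auto intro: less_le_trans\<close>)
  then obtain K where K: "\<And>i g'. i < length qs \<Longrightarrow> (\<forall>x<K. g' x = g x) \<Longrightarrow> oeval g' (qs ! i) xs (ys ! i)"
    by blast
  obtain K' where K': "\<And>g'. (\<forall>x<K'. g' x = g x) \<Longrightarrow> oeval g' p ys z"
    using oeval_Comp.IH by blast
  show ?case
    by (rule exI[of _ "max K K'"])
       (use K K' oeval_Comp.hyps in \<open>auto intro!: oeval.oeval_Comp[where ys = ys]\<close>)
next
  case (oeval_Prec_0 p xs z q)
  then show ?case by (meson oeval.oeval_Prec_0)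
next
  case (oeval_Prec_Suc p q n xs y z)
  obtain K where K: "\<And>g'. (\<forall>x<K. g' x = g x) \<Longrightarrow> oeval g' (Prec p q) (n # xs) y"
    using oeval_Prec_Suc.IH by blast
  obtain K' where K': "\<And>g'. (\<forall>x<K'. g' x = g x) \<Longrightarrow> oeval g' q (n # y # xs) z"
    using oeval_Prec_Suc.IH by blast
  show ?case
    by (rule exI[of _ "max K K'"]) (use K K' in \<open>auto intro!: oeval.oeval_Prec_Suc[where y = y]\<close>)
next
  case (oeval_Mu p n xs)
  obtain K where K: "\<And>g'. (\<forall>x<K. g' x = g x) \<Longrightarrow> oeval g' p (n # xs) 0"
    using oeval_Mu.IH by blast
  have "\<exists>K. \<forall>i<n. \<exists>y>0. \<forall>g'. (\<forall>x<K. g' x = g x) \<longrightarrow> oeval g' p (i # xs) y"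
  proof (rule bounded_uniform)
    fix i assume "i < n"
    then show "\<exists>K. \<exists>y>0. \<forall>g'. (\<forall>x<K. g' x = g x) \<longrightarrow> oeval g' p (i # xs) y"
      using oeval_Mu.IH(2) by blast
  next
    fix K K' :: nat and i
    assume "\<exists>y>0. \<forall>g'. (\<forall>x<K. g' x = g x) \<longrightarrow> oeval g' p (i # xs) y" "K \<le> K'"
    then show "\<exists>y>0. \<forall>g'. (\<forall>x<K'. g' x = g x) \<longrightarrow> oeval g' p (i # xs) y"
      by (meson less_le_trans)
  qed
  then obtain K' where K': "\<And>i. i < n \<Longrightarrow> \<exists>y>0. \<forall>g'. (\<forall>x<K'. g' x = g x) \<longrightarrow> oeval g' p (i # xs) y"
    by blast
  show ?case
  proof (rule exI[of _ "max K K'"], intro allI impI oeval.oeval_Mu)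
    fix g' assume "\<forall>x<max K K'. g' x = g x"
    then show "oeval g' p (n # xs) 0" using K by simp
  next
    fix g' i assume g': "\<forall>x<max K K'. g' x = g x" and "i < n"
    then obtain y where "y > 0" "\<forall>g'. (\<forall>x<K'. g' x = g x) \<longrightarrow> oeval g' p (i # xs) y"
      using K' by blast
    then show "\<exists>y>0. oeval g' p (i # xs) y" using g' by auto
  qed
qed (auto intro: oeval.intros)

text \<open>Turns a bound on oracle arguments into a bound on the lengths of the words whose colors
  are queried.\<close>

lemma length_le_list_encode: "length xs \<le> list_encode xs"
proof (induction xs)
  case (Cons x xs)
  then show ?case using le_prod_encode_2[of "list_encode xs" x] by simp
qed simp

section \<open>Diagonalizing against all programs\<close>

definition agree :: "nat \<Rightarrow> (nat list \<Rightarrow> nat) \<Rightarrow> (nat list \<Rightarrow> nat) \<Rightarrow> bool" where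
  "agree M c c' \<longleftrightarrow> (\<forall>w. length w < M \<longrightarrow> c w = c' w)"

text \<open>Quantifying over all colorings that agree below \<open>M\<close> makes this a property
  of the colors of words shorter than \<open>M\<close>, so it may be used while \<open>c\<close> is
  being defined.\<close>

definition decides :: "nat \<Rightarrow> (nat list \<Rightarrow> nat) \<Rightarrow> nat \<Rightarrow> oprog \<Rightarrow> nat \<Rightarrow> nat \<Rightarrow> bool" where
  "decides d c M p t y \<longleftrightarrow> (\<forall>c'. agree M c c' \<longrightarrow> oeval (coloring_oracle d c') p [t] y)"

text \<open>The arbitrary values where the program does not halt do no harm: blocks are formed from
  decided arguments only.\<close>

definition result :: "nat \<Rightarrow> (nat list \<Rightarrow> nat) \<Rightarrow> oprog \<Rightarrow> nat \<Rightarrow> nat" where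
  "result d c p t = (THE y. oeval (coloring_oracle d c) p [t] y)"

lemma result_eq: "oeval (coloring_oracle d c) p [t] y \<Longrightarrow> result d c p t = y"
  unfolding result_def by (blast intro: oeval_deterministic)

lemma decides_mono: "decides d c M p t y \<Longrightarrow> M \<le> M' \<Longrightarrow> decides d c M' p t y"
  unfolding decides_def agree_def by (meson less_le_trans)

lemma decides_cong: "agree M c c' \<Longrightarrow> decides d c M p t y \<longleftrightarrow> decides d c' M p t y"
  unfolding decides_def agree_def by simp

lemma result_cong: "agree M c c' \<Longrightarrow> decides d c M p t y \<Longrightarrow> result d c p t = result d c' p t"
  unfolding decides_def by (metis agree_def result_eq)

lemma oeval_decides:
  assumes "oeval (coloring_oracle d c) p [t] y"
  shows "\<exists>M. decides d c M p t y"
proof -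
  obtain K where K: "\<And>g'. (\<forall>x<K. g' x = coloring_oracle d c x) \<Longrightarrow> oeval g' p [t] y"
    using oeval_use[OF assms] by blast
  have "length (list_decode x) < K" if "x < K" for x
    using length_le_list_encode[of "list_decode x"] that by simp
  then have "decides d c K p t y"
    unfolding decides_def agree_def by (auto intro!: K simp: coloring_oracle_def)
  then show ?thesis ..
qed

text \<open>Variables have odd codes, so for a sequence \<open>f\<close> of symbol codes these are first occurrences.\<close>

definition fresh :: "(nat \<Rightarrow> nat) \<Rightarrow> nat \<Rightarrow> nat \<Rightarrow> nat set" where
  "fresh f B T = {t \<in> {B..<T}. odd (f t) \<and> (\<forall>t'<t. f t' \<noteq> f t)}"

lemma fresh_cong: "(\<And>t. t < T \<Longrightarrow> f t = f' t) \<Longrightarrow> fresh f B T = fresh f' B T"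
  by (auto simp: fresh_def)

lemma finite_fresh [simp]: "finite (fresh f B T)"
  by (simp add: fresh_def)

text \<open>
  The state \<open>(r, P, B)\<close> lists in \<open>P\<close> the positions reserved so far, in blocks of sizes
  \<open>X 0, \<dots>, X (r - 1)\<close>, all below \<open>B\<close>.
\<close>

definition ready :: "nat \<Rightarrow> (nat list \<Rightarrow> nat) \<Rightarrow> nat \<Rightarrow> oprog \<Rightarrow> nat \<Rightarrow> nat \<Rightarrow> bool" where
  "ready d c M p B n \<longleftrightarrow>
     (\<exists>T\<le>M. card (fresh (result d c p) B T) = n \<and> (\<forall>t<T. \<exists>y. decides d c M p t y))"

text \<open>Independent of \<open>M\<close>: from the same \<open>B\<close>, a program that is ready
  keeps its block as \<open>M\<close> grows.\<close>

definition block_end :: "nat \<Rightarrow> (nat list \<Rightarrow> nat) \<Rightarrow> oprog \<Rightarrow> nat \<Rightarrow> nat \<Rightarrow> nat" where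
  "block_end d c p B n = (LEAST T. card (fresh (result d c p) B T) = n)"

definition step :: "nat \<Rightarrow> (nat \<Rightarrow> nat) \<Rightarrow> (nat list \<Rightarrow> nat) \<Rightarrow> nat \<Rightarrow> oprog \<Rightarrow>
    nat \<times> nat list \<times> nat \<Rightarrow> nat \<times> nat list \<times> nat" where
  "step d X c M p = (\<lambda>(r, P, B).
     if ready d c M p B (X r)
     then let T = block_end d c p B (X r)
       in (Suc r, P @ sorted_list_of_set (fresh (result d c p) B T), T)
     else (r, P, B))"

primrec reserve :: "nat \<Rightarrow> (nat \<Rightarrow> nat) \<Rightarrow> (nat list \<Rightarrow> nat) \<Rightarrow> nat \<Rightarrow> nat \<Rightarrow> nat \<times> nat list \<times> nat" where
  "reserve d X c M 0 = (0, [], 0)"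
| "reserve d X c M (Suc e) = step d X c M (from_nat e) (reserve d X c M e)"

lemma ready_mono: "ready d c M p B n \<Longrightarrow> M \<le> M' \<Longrightarrow> ready d c M' p B n"
  unfolding ready_def using decides_mono[of d c M p _ _ M'] le_trans[of _ M M'] by (elim exE) blast

lemma agree_sym: "agree M c c' \<Longrightarrow> agree M c' c"
  by (simp add: agree_def)

text \<open>All values below the witness \<open>T\<close> are decided, hence the same for both
  colorings; \<open>block_end\<close> is at most \<open>T\<close>, so it and the block agree
  too.\<close>

lemma ready_cong:
  assumes "agree M c c'" "ready d c M p B n"
  shows "ready d c' M p B n" "block_end d c' p B n = block_end d c p B n"
    "fresh (result d c' p) B (block_end d c p B n) = fresh (result d c p) B (block_end d c p B n)"
proof -
  obtain T where T: "T \<le> M" "card (fresh (result d c p) B T) = n" "\<forall>t<T. \<exists>y. decides d c M p t y"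
    using assms(2) unfolding ready_def by blast
  have fresh: "fresh (result d c p) B S = fresh (result d c' p) B S" if "S \<le> T" for S
    by (rule fresh_cong) (use T(3) that result_cong[OF assms(1)] in \<open>meson less_le_trans\<close>)
  have le: "block_end d c p B n \<le> T"
    unfolding block_end_def using T(2) by (rule Least_le)
  show "ready d c' M p B n"
    unfolding ready_def using T fresh[of T] decides_cong[OF assms(1)] by auto
  show "block_end d c' p B n = block_end d c p B n"
    unfolding block_end_def
  proof (rule Least_equality)
    show "card (fresh (result d c' p) B (LEAST T. card (fresh (result d c p) B T) = n)) = n"
      using LeastI[of "\<lambda>T. card (fresh (result d c p) B T) = n" T] T(2) fresh le
      unfolding block_end_def by simp
    fix S assume S: "card (fresh (result d c' p) B S) = n"
    show "(LEAST T. card (fresh (result d c p) B T) = n) \<le> S"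
    proof (cases "S \<le> T")
      case True
      then show ?thesis using S fresh by (intro Least_le) simp
    next
      case False
      then show ?thesis using le unfolding block_end_def by simp
    qed
  qed
  show "fresh (result d c' p) B (block_end d c p B n) = fresh (result d c p) B (block_end d c p B n)"
    using fresh[OF le] by (rule sym)
qed

lemma reserve_cong:
  assumes "agree M c c'"
  shows "reserve d X c M e = reserve d X c' M e"
proof (induction e)
  case (Suc e)
  have "step d X c M p s = step d X c' M p s" for p s
  proof (cases s)
    case (fields r P B)
    show ?thesis
    proof (cases "ready d c M p B (X r)")
      case True
      from ready_cong[OF assms this] show ?thesis
        using True by (simp add: step_def fields Let_def)
    next
      case False
      then have "\<not> ready d c' M p B (X r)"
        using ready_cong[OF agree_sym[OF assms]] by blast
      with False show ?thesis by (simp add: step_def fields)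
    qed
  qed
  with Suc show ?case by simp
qed simp

text \<open>Once the state left by the earlier programs is final, program \<open>e\<close> can
  change its contribution only once, from unready to ready.\<close>

lemma reserve_stabilizes: "\<exists>M0. \<forall>M\<ge>M0. reserve d X c M e = reserve d X c M0 e"
proof (induction e)
  case (Suc e)
  then obtain M0 where M0: "\<And>M. M \<ge> M0 \<Longrightarrow> reserve d X c M e = reserve d X c M0 e" by blast
  obtain r P B where s: "reserve d X c M0 e = (r, P, B)" by (cases "reserve d X c M0 e")
  show ?case
  proof (cases "\<exists>M1\<ge>M0. ready d c M1 (from_nat e) B (X r)")
    case True
    then obtain M1 where M1: "M1 \<ge> M0" "ready d c M1 (from_nat e) B (X r)" by blast
    show ?thesis
      by (rule exI[of _ M1]) (use M0 M1 s ready_mono in \<open>auto simp: step_def\<close>)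
  next
    case False
    then show ?thesis
      by (intro exI[of _ M0]) (use M0 s in \<open>auto simp: step_def\<close>)
  qed
qed simp

lemma ready_block_end:
  assumes "ready d c M p B n" "n > 0"
  shows "card (fresh (result d c p) B (block_end d c p B n)) = n"
    "block_end d c p B n \<le> M" "B < block_end d c p B n"
proof -
  obtain T where T: "T \<le> M" "card (fresh (result d c p) B T) = n"
    using assms(1) unfolding ready_def by blast
  show card: "card (fresh (result d c p) B (block_end d c p B n)) = n"
    unfolding block_end_def using T(2) by (rule LeastI)
  show "block_end d c p B n \<le> M"
    using T Least_le[of "\<lambda>T. card (fresh (result d c p) B T) = n" T] unfolding block_end_def by simp
  show "B < block_end d c p B n"
  proof (rule ccontr)
    assume "\<not> B < block_end d c p B n"
    then have "fresh (result d c p) B (block_end d c p B n) = {}" by (auto simp: fresh_def)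
    then show False using card assms(2) by simp
  qed
qed

text \<open>New blocks start at the old \<open>B\<close>, which keeps \<open>P\<close> increasing.
  \<open>B \<le> M\<close> puts the reserved positions inside words of length \<open>M\<close>, and
  the length of \<open>P\<close> is the one that \<open>F r\<close> expects.\<close>

lemma reserve_invariant:
  assumes "\<And>i. X i > 0" "reserve d X c M e = (r, P, B)"
  shows "sorted_wrt (<) P \<and> set P \<subseteq> {..<B} \<and> B \<le> M \<and> length P = sum_list (map X [0..<r])"
  using assms(2)
proof (induction e arbitrary: r P B)
  case (Suc e)
  obtain r' P' B' where s: "reserve d X c M e = (r', P', B')" by (cases "reserve d X c M e")
  note IH = Suc.IH[OF s]
  show ?case
  proof (cases "ready d c M (from_nat e) B' (X r')")
    case True
    note be = ready_block_end[OF True assms(1)]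
    let ?f = "result d c (from_nat e)"
    let ?T = "block_end d c (from_nat e) B' (X r')"
    have eq: "r = Suc r'" "P = P' @ sorted_list_of_set (fresh ?f B' ?T)" "B = ?T"
      using Suc.prems True by (auto simp: s step_def Let_def)
    have "x < y" if "x \<in> set P'" "y \<in> fresh ?f B' ?T" for x y
      using IH that by (fastforce simp: fresh_def)
    moreover have "fresh ?f B' ?T \<subseteq> {..<?T}" by (auto simp: fresh_def)
    ultimately show ?thesis
      using IH be unfolding eq by (auto simp: sorted_wrt_append)
  qed (use Suc.prems IH s in \<open>auto simp: step_def\<close>)
qed simp

lemma reserve_prefix:
  assumes "e \<le> e'" "reserve d X c M e = (r, P, B)" "reserve d X c M e' = (r', P', B')"
  shows "r \<le> r' \<and> (\<exists>Z. P' = P @ Z)"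
  using assms(1,3)
proof (induction e' arbitrary: r' P' B' rule: dec_induct)
  case base
  then show ?case using assms(2) by simp
next
  case (step e')
  obtain r1 P1 B1 where s: "reserve d X c M e' = (r1, P1, B1)" by (cases "reserve d X c M e'")
  show ?case using step.IH[OF s] step.prems by (auto simp: s step_def Let_def split: if_splits)
qed

text \<open>\<open>length w\<close> is both the stage and the number of programs treated. With
  nothing reserved the color is \<open>0\<close>, as no bad coloring is available for
  \<open>r = 0\<close>.\<close>

definition coloring_step :: "nat \<Rightarrow> (nat \<Rightarrow> nat) \<Rightarrow> (nat \<Rightarrow> nat list \<Rightarrow> nat) \<Rightarrow>
    (nat list \<Rightarrow> nat) \<Rightarrow> nat list \<Rightarrow> nat" where
  "coloring_step d X F c w = (case reserve d X c (length w) (length w) of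
     (r, P, B) \<Rightarrow> if r = 0 then 0 else F r (map ((!) w) P))"

text \<open>Stage \<open>length w\<close> depends only on the colors of shorter words, so
  well-founded recursion on the length applies.\<close>

lemma exists_diagonal_coloring: "\<exists>c. \<forall>w. c w = coloring_step d X F c w"
proof -
  have "adm_wf (measure length) (coloring_step d X F)"
    unfolding adm_wf_def
  proof (intro allI impI)
    fix c c' :: "nat list \<Rightarrow> nat" and w
    assume "\<forall>z. (z, w) \<in> measure length \<longrightarrow> c z = c' z"
    then have "agree (length w) c c'" by (simp add: agree_def)
    from reserve_cong[OF this] show "coloring_step d X F c w = coloring_step d X F c' w"
      by (simp add: coloring_step_def)
  qed
  from wfrec_fixpoint[OF wf_measure this] show ?thesis by metis
qed

section \<open>Blocks of first occurrences in an infinite variable word\<close>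

lemma infinite_card_segment:
  fixes A :: "nat set"
  assumes "infinite A"
  shows "\<exists>T. card (A \<inter> {B..<T}) = n"
proof (induction n)
  case 0
  show ?case by (intro exI[of _ 0]) simp
next
  case (Suc n)
  then obtain T where T: "card (A \<inter> {B..<T}) = n" by blast
  define t where "t = (LEAST t. t \<in> A \<and> max T B \<le> t)"
  have "\<exists>t. t \<in> A \<and> max T B \<le> t"
    using assms unfolding infinite_nat_iff_unbounded_le by blast
  then have t: "t \<in> A" "max T B \<le> t"
    using LeastI_ex[of "\<lambda>t. t \<in> A \<and> max T B \<le> t"] unfolding t_def by auto
  have "A \<inter> {B..<Suc t} = insert t (A \<inter> {B..<T})"
    using t not_less_Least[of _ "\<lambda>t. t \<in> A \<and> max T B \<le> t"] unfolding t_def[symmetric]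
    by (auto simp: less_Suc_eq) (meson linorder_not_le order.trans)
  then have "card (A \<inter> {B..<Suc t}) = Suc n" using T t by auto
  then show ?case ..
qed

lemma var_index_enumerate:
  assumes "infinite (vars v)"
  shows "var_index v (enumerate (vars v) i) = i"
proof -
  have "{x \<in> vars v. x < enumerate (vars v) i} = enumerate (vars v) ` {..<i}"
  proof (intro equalityI subsetI)
    fix x assume x: "x \<in> {x \<in> vars v. x < enumerate (vars v) i}"
    then obtain l where "x = enumerate (vars v) l" using enumerate_Ex[OF assms] by blast
    then show "x \<in> enumerate (vars v) ` {..<i}" using x assms by simp
  qed (use assms enumerate_in_set in auto)
  moreover have "inj_on (enumerate (vars v)) {..<i}"
    using assms by (auto simp: inj_on_def enumerate_mono_iff strict_mono_eq strict_mono_enumerate)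
  ultimately show ?thesis unfolding var_index_def by (simp add: card_image)
qed

lemma symb_encode_inject: "symb_encode s = symb_encode s' \<longleftrightarrow> s = s'"
  by (cases s; cases s') (auto, presburger+)

lemma fresh_symb_encode:
  assumes "dom v = UNIV"
  shows "fresh (\<lambda>t. symb_encode (the (v t))) B T = first_occ v ` vars v \<inter> {B..<T}"
proof -
  have "odd (symb_encode (the (v t))) \<and> (\<forall>t'<t. symb_encode (the (v t')) \<noteq> symb_encode (the (v t)))
      \<longleftrightarrow> t \<in> first_occ v ` vars v" for t
  proof -
    obtain s where s: "v t = Some s" using assms by blast
    show ?thesis
    proof (cases s)
      case (Letter a)
      then show ?thesis using s first_occ_in[of _ v] by auto
    next
      case (Var x)
      have x: "x \<in> vars v" "first_occ v x \<le> t" using first_occ_le[of v t x] s Var by auto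
      have "(\<forall>t'<t. the (v t') \<noteq> Var x) \<longleftrightarrow> first_occ v x = t"
      proof
        assume "\<forall>t'<t. the (v t') \<noteq> Var x"
        then show "first_occ v x = t" using first_occ_in[OF x(1)] x(2) by (metis le_neq_implies_less option.sel)
      next
        assume "first_occ v x = t"
        then show "\<forall>t'<t. the (v t') \<noteq> Var x"
          using first_occ_le[of v _ x] assms by (metis UNIV_I domD leD option.sel)
      qed
      moreover have "t \<in> first_occ v ` vars v \<longleftrightarrow> first_occ v x = t"
        using first_occ_in[of _ v] s Var x(1) by force
      ultimately show ?thesis by (simp add: s Var symb_encode_inject[of _ "Var x", simplified])
    qed
  qed
  then show ?thesis by (auto simp: fresh_def)
qed

text \<open>
  \<open>P\<close> is the list of all reserved positions and \<open>D\<close> the block of one program, which becomes a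
  section of the restricted word.
\<close>

definition restrict_word :: "symb_seq \<Rightarrow> nat list \<Rightarrow> nat set \<Rightarrow> symb_seq" where
  "restrict_word v P D t = (if t < length P then
     (case v (P ! t) of Some (Var x) \<Rightarrow> Some (if first_occ v x \<in> D then Var x else Letter 0) | s \<Rightarrow> s)
     else None)"

text \<open>Keeping just the variables that first occur in \<open>D\<close> makes the places of
  \<open>D\<close> within \<open>P\<close> the section of \<open>u\<close>. Every instance of
  \<open>u\<close> is the restriction of an instance of \<open>v\<close> in which the omitted
  variables get \<open>0\<close>.\<close>

lemma restrict_word_correct:
  assumes d: "d > 0" and v: "n_variable_word d \<infinity> v"
    and P: "sorted_wrt (<) P" "i + n \<le> length P"
    and D: "D = (!) P ` {i..<i + n}" "D \<subseteq> first_occ v ` vars v"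
  defines "u \<equiv> restrict_word v P D"
  shows "n_variable_word d (enat n) u" "dom u = {..<length P}" "first_occ u ` vars u = {i..<i + n}"
    and "b \<in> words_of_length d n \<Longrightarrow> set P \<subseteq> {..<first_occ v (enumerate (vars v) m)} \<Longrightarrow>
      \<exists>a\<in>words_of_length d m. map ((!) (subst v a)) P = subst u b"
proof -
  have dom_v: "dom v = UNIV" and inf: "infinite (vars v)"
    and mono: "\<And>x y. x \<in> vars v \<Longrightarrow> y \<in> vars v \<Longrightarrow> x < y \<Longrightarrow> first_occ v x < first_occ v y"
    and nv: "num_vars v = \<infinity>"
    using v by (auto simp: n_variable_word_def num_vars_def split: if_splits)
  have letter: "a < d" if "v t = Some (Letter a)" for t a
    using v that by (auto simp: n_variable_word_def variable_word_def ran_def)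
  have P_less: "P ! s < P ! t \<longleftrightarrow> s < t" if "s < length P" "t < length P" for s t
    using sorted_wrt_nth_less[OF P(1), of s t] sorted_wrt_nth_less[OF P(1), of t s] that
    by (cases s t rule: linorder_cases) auto
  have u_some: "u t = Some (case the (v (P ! t)) of Letter a \<Rightarrow> Letter a
      | Var x \<Rightarrow> if first_occ v x \<in> D then Var x else Letter 0)" if "t < length P" for t
  proof -
    obtain s where "v (P ! t) = Some s" using dom_v by blast
    then show ?thesis using that by (simp add: u_def restrict_word_def split: symb.split)
  qed
  show dom: "dom u = {..<length P}"
    using u_some by (auto simp: u_def restrict_word_def split: if_splits)
  have u_Var: "u t = Some (Var x) \<longleftrightarrow> t < length P \<and> v (P ! t) = Some (Var x) \<and> first_occ v x \<in> D" for t x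
  proof (cases "t < length P")
    case True
    obtain s where "v (P ! t) = Some s" using dom_v by blast
    then show ?thesis using True by (auto simp: u_some split: symb.split)
  next
    case False
    then show ?thesis by (simp add: u_def restrict_word_def)
  qed
  have first: "x \<in> vars u \<and> first_occ u x = t"
    if "x \<in> vars v" "first_occ v x = P ! t" "t \<in> {i..<i + n}" for x t
  proof -
    have t: "t < length P" using that P(2) by simp
    have ut: "u t = Some (Var x)"
      using first_occ_in[OF that(1)] that t D(1) by (simp add: u_Var)
    \<comment> \<open>An earlier occurrence of \<open>x\<close> in \<open>u\<close> would be an
      earlier one in \<open>v\<close>, as \<open>P\<close> is increasing.\<close>
    have "t \<le> t'" if "u t' = Some (Var x)" for t'
      using that first_occ_le[of v "P ! t'" x] \<open>first_occ v x = P ! t\<close> P_less[of t' t] t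
      by (auto simp: u_Var not_less[symmetric])
    then have "first_occ u x = t"
      unfolding first_occ_def occurrences_def using ut by (auto intro!: Least_equality)
    then show ?thesis using first_occ_le[of u t x, OF ut] by simp
  qed
  have vars_u: "x \<in> vars v \<and> (\<exists>t\<in>{i..<i + n}. first_occ v x = P ! t)" if x: "x \<in> vars u" for x
  proof -
    obtain t where "u t = Some (Var x)" using first_occ_in[OF x] by blast
    then show ?thesis using first_occ_le[of v "P ! t" x] D(1) by (auto simp: u_Var)
  qed
  show image: "first_occ u ` vars u = {i..<i + n}"
  proof (intro equalityI subsetI)
    fix t assume "t \<in> {i..<i + n}"
    moreover from this obtain x where "x \<in> vars v" "first_occ v x = P ! t" using D by fastforce
    ultimately show "t \<in> first_occ u ` vars u" using first by blast
  qed (use vars_u first in blast)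
  have mono_u: "first_occ u x < first_occ u y" if xy: "x \<in> vars u" "y \<in> vars u" "x < y" for x y
  proof -
    obtain s t where st: "s \<in> {i..<i + n}" "first_occ v x = P ! s" "t \<in> {i..<i + n}" "first_occ v y = P ! t"
      using vars_u[OF xy(1)] vars_u[OF xy(2)] by blast
    moreover have "P ! s < P ! t" using mono[of x y] vars_u xy st by auto
    ultimately show ?thesis using first vars_u xy P_less[of s t] P(2) by auto
  qed
  have inj: "inj_on (first_occ u) (vars u)"
    by (rule linorder_inj_onI) (auto dest: mono_u)
  have fin_u: "finite (vars u)" and card_u: "card (vars u) = n"
    using image inj finite_imageD[of "first_occ u" "vars u"] card_image[OF inj] by auto
  have "variable_word d u"
    unfolding variable_word_def
  proof (intro conjI exI[of _ "enat (length P)"] allI impI)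
    show "dom u = {t. enat t < enat (length P)}" using dom by auto
    fix a assume "Letter a \<in> ran u"
    then obtain t where t: "u t = Some (Letter a)" by (auto simp: ran_def)
    then have "t < length P" using dom by blast
    moreover obtain s where "v (P ! t) = Some s" using dom_v by blast
    ultimately show "a < d" using t letter[of "P ! t"] d
      by (auto simp: u_some split: symb.splits if_splits)
  qed
  then show "n_variable_word d (enat n) u"
    using mono_u fin_u card_u by (auto simp: n_variable_word_def num_vars_def)
  assume b: "b \<in> words_of_length d n" and PM: "set P \<subseteq> {..<first_occ v (enumerate (vars v) m)}"
  have vi_u: "var_index u x < n" if "x \<in> vars u" for x
  proof -
    have "card {m' \<in> vars u. m' < x} < card (vars u)"
      using that fin_u by (intro psubset_card_mono) auto
    then show ?thesis by (simp add: var_index_def card_u)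
  qed
  define a where "a = map (\<lambda>l. let x = enumerate (vars v) l in
    if x \<in> vars u then b ! var_index u x else 0) [0..<m]"
  have a_len: "length a = m" by (simp add: a_def)
  have "a \<in> words_of_length d m"
    using vi_u b d by (auto simp: a_def words_of_length_def Let_def words_def)
  moreover have "map ((!) (subst v a)) P = subst u b"
  proof (rule nth_equalityI)
    have sl: "subst_length u b = length P"
      using b fin_u card_u by (simp add: subst_length_def num_vars_def dom words_of_length_def)
    then show "length (map ((!) (subst v a)) P) = length (subst u b)" by (simp add: subst_def)
    fix t assume "t < length (map ((!) (subst v a)) P)"
    then have t: "t < length P" by simp
    then have Pt: "P ! t < first_occ v (enumerate (vars v) m)" using PM nth_mem by blast
    obtain s where s: "v (P ! t) = Some s" using dom_v by blast
    have lhs: "map ((!) (subst v a)) P ! t = subst_symb v a s"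
      using t Pt s by (simp add: subst_def subst_length_def nv a_len)
    have rhs: "subst u b ! t = subst_symb u b (the (u t))"
      using t sl by (simp add: subst_def)
    show "map ((!) (subst v a)) P ! t = subst u b ! t"
    proof (cases s)
      case (Letter l)
      then show ?thesis unfolding lhs rhs using t s by (simp add: u_some subst_symb_def)
    next
      case (Var x)
      have x: "x \<in> vars v" "first_occ v x \<le> P ! t" using first_occ_le[of v "P ! t" x] s Var by auto
      obtain l where l: "x = enumerate (vars v) l" using range_enumerate[OF inf] x(1) by blast
      \<comment> \<open>A variable of index \<open>m\<close> or more first occurs too late to stand
        at a position in \<open>P\<close>.\<close>
      have "l < m"
      proof (rule ccontr)
        assume "\<not> l < m"
        then have "enumerate (vars v) m \<le> x" unfolding l using inf by (simp add: enumerate_mono_le_iff)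
        then have "first_occ v (enumerate (vars v) m) \<le> first_occ v x"
          using mono[OF enumerate_in_set[OF inf] x(1), of m] by (auto simp: le_less)
        then show False using x(2) Pt by simp
      qed
      then have val: "subst_symb v a s = (if x \<in> vars u then b ! var_index u x else 0)"
        using inf by (simp add: Var subst_symb_def l var_index_enumerate a_def Let_def)
      have "x \<in> vars u \<longleftrightarrow> first_occ v x \<in> D"
        using vars_u[of x] first[OF x(1)] D(1) by blast
      then show ?thesis unfolding lhs rhs val using t s Var by (simp add: u_some subst_symb_def)
    qed
  qed
  ultimately show "\<exists>a\<in>words_of_length d m. map ((!) (subst v a)) P = subst u b" by blast
qed

text \<open>If \<open>p\<close> computed a solution \<open>v\<close>, its block \<open>D\<close>
  would be section \<open>r\<close> of the reserved positions at some stage \<open>M\<close>. The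
  instances of \<open>v\<close> of length \<open>M\<close> are colored by \<open>F r'\<close> on
  those positions, so that section would be homogeneous.\<close>

lemma ENSH_sequence_imp_no_computable_solution:
  assumes d: "d > 0" and k: "k > 0" and X: "X \<in> ENSH_sequences d k"
  shows "\<exists>c. VWI_instance d k c \<and> \<not> (\<exists>v. VWI_solution d c v \<and> coloring_computable d c v)"
proof -
  have X_pos: "X i > 0" for i using X by (simp add: ENSH_sequences_def)
  define start where "start r = sum_list (map X [0..<r])" for r
  have "\<forall>r. \<exists>f. r > 0 \<longrightarrow> f \<in> words_of_length d (start r) \<rightarrow> {..<k} \<and>
      \<not> sectionally_homogeneous d (map X [0..<r]) f"
    using X by (auto simp: ENSH_sequences_def ENSH_def start_def)
  from choice[OF this] obtain F where F: "\<And>r. r > 0 \<Longrightarrow> F r \<in> words_of_length d (start r) \<rightarrow> {..<k}"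
    "\<And>r. r > 0 \<Longrightarrow> \<not> sectionally_homogeneous d (map X [0..<r]) (F r)"
    by blast
  obtain c where c: "\<And>w. c w = coloring_step d X F c w"
    using exists_diagonal_coloring by blast
  have inst: "VWI_instance d k c"
    unfolding VWI_instance_def
  proof
    fix w assume w: "w \<in> words d"
    obtain r P B where s: "reserve d X c (length w) (length w) = (r, P, B)"
      by (cases "reserve d X c (length w) (length w)")
    note inv = reserve_invariant[OF X_pos s]
    have "map ((!) w) P \<in> words_of_length d (start r)"
      using inv w words_nth[OF w] by (fastforce simp: words_of_length_def words_def start_def)
    then show "c w \<in> {..<k}"
      using F(1)[of r] k by (auto simp: c[of w] coloring_step_def s)
  qed
  have "\<not> (VWI_solution d c v \<and> coloring_computable d c v)" for v
  proof
    assume "VWI_solution d c v \<and> coloring_computable d c v"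
    then obtain j p where v: "n_variable_word d \<infinity> v" and hom: "\<And>a. a \<in> words d \<Longrightarrow> c (subst v a) = j"
      and p: "\<And>t. oeval (coloring_oracle d c) p [t] (symb_encode (the (v t)))"
      unfolding VWI_solution_def coloring_computable_def computable_in_def by blast
    define e where "e = to_nat p"
    have dom: "dom v = UNIV" and inf: "infinite (vars v)" and nv: "num_vars v = \<infinity>"
      and mono: "\<And>x y. x \<in> vars v \<Longrightarrow> y \<in> vars v \<Longrightarrow> x < y \<Longrightarrow> first_occ v x < first_occ v y"
      using v by (auto simp: n_variable_word_def num_vars_def split: if_splits)
    have fresh: "fresh (result d c p) B T = first_occ v ` vars v \<inter> {B..<T}" for B T
      unfolding fresh_symb_encode[OF dom, symmetric]
      by (rule fresh_cong) (rule result_eq[OF p])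
    have "inj_on (first_occ v) (vars v)"
      by (rule linorder_inj_onI) (auto dest: mono)
    then have inf': "infinite (first_occ v ` vars v)"
      using inf finite_image_iff by blast
    obtain M0 where M0: "\<And>M. M \<ge> M0 \<Longrightarrow> reserve d X c M e = reserve d X c M0 e"
      using reserve_stabilizes by blast
    obtain r P B where s0: "reserve d X c M0 e = (r, P, B)" by (cases "reserve d X c M0 e")
    obtain T where T: "card (fresh (result d c p) B T) = X r"
      using infinite_card_segment[OF inf'] fresh by metis
    have "\<exists>M. \<forall>t<T. \<exists>y. decides d c M p t y"
      by (rule bounded_uniform) (use oeval_decides[OF p] decides_mono in blast)+
    then obtain M1 where M1: "\<forall>t<T. \<exists>y. decides d c M1 p t y" by blast
    \<comment> \<open>Large enough for a final state before program \<open>e\<close>, for decided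
      values up to \<open>T\<close>, and for program \<open>e\<close> to be among those treated at
      stage \<open>M\<close>.\<close>
    define m where "m = Max {M0, M1, T, Suc e}"
    have m: "M0 \<le> m" "M1 \<le> m" "T \<le> m" "Suc e \<le> m" by (simp_all add: m_def)
    \<comment> \<open>The common length of all \<open>subst v a\<close> with
      \<open>length a = m\<close>, so that a single stage colors them all.\<close>
    define M where "M = first_occ v (enumerate (vars v) m)"
    have "l \<le> first_occ v (enumerate (vars v) l)" for l
    proof (rule strict_mono_imp_increasing)
      show "strict_mono (\<lambda>l. first_occ v (enumerate (vars v) l))"
        by (rule strict_monoI) (use inf in \<open>simp add: mono enumerate_in_set enumerate_mono_iff\<close>)
    qed
    then have mM: "m \<le> M" unfolding M_def by simp
    have ready: "ready d c M p B (X r)"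
      using m mM T M1 decides_mono[of d c M1 p _ _ M] unfolding ready_def by (meson le_trans)
    define D where "D = fresh (result d c p) B (block_end d c p B (X r))"
    have card_D: "card D = X r" unfolding D_def by (rule ready_block_end(1)[OF ready X_pos])
    have fin_D: "finite D" by (simp add: D_def)
    have step: "reserve d X c M (Suc e) = (Suc r, P @ sorted_list_of_set D, block_end d c p B (X r))"
      using M0[of M] m mM s0 ready by (simp add: step_def e_def Let_def D_def)
    obtain r' P' B' where s': "reserve d X c M M = (r', P', B')" by (cases "reserve d X c M M")
    \<comment> \<open>Later programs only append to \<open>P\<close>, so the block \<open>D\<close>
      keeps its place.\<close>
    obtain Z where r': "Suc r \<le> r'" and P': "P' = P @ sorted_list_of_set D @ Z"
      using reserve_prefix[OF _ step s'] m mM by auto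
    note inv = reserve_invariant[OF X_pos s']
    have len_P: "length P = start r"
      using reserve_invariant[OF X_pos s0] by (simp add: start_def)
    have len_P': "length P' = start r'" using inv by (simp add: start_def)
    have D_image: "D = (!) P' ` {start r..<start r + X r}"
    proof -
      have "D = set (sorted_list_of_set D)" using fin_D by simp
      also have "sorted_list_of_set D = map ((!) P') [start r..<start r + X r]"
        by (rule nth_equalityI) (auto simp: P' nth_append len_P card_D)
      finally show ?thesis by simp
    qed
    have D_first: "D \<subseteq> first_occ v ` vars v" unfolding D_def fresh by blast
    have P'_len: "start r + X r \<le> length P'" by (simp add: P' len_P card_D)
    have P'_sorted: "sorted_wrt (<) P'" using inv by blast
    define u where "u = restrict_word v P' D"
    note ru = restrict_word_correct[OF d v P'_sorted P'_len D_image D_first, folded u_def]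
    have "F r' (subst u b) = j" if "b \<in> words_of_length d (X r)" for b
    proof -
      have "set P' \<subseteq> {..<M}" using inv by auto
      from ru(4)[OF that this[unfolded M_def]] obtain a where a: "a \<in> words_of_length d m"
        "map ((!) (subst v a)) P' = subst u b" by blast
      have "length (subst v a) = M"
        using a(1) by (simp add: subst_def subst_length_def nv words_of_length_def M_def)
      then have "c (subst v a) = F r' (map ((!) (subst v a)) P')"
        using r' by (simp add: c[of "subst v a"] coloring_step_def s')
      then show ?thesis using hom[of a] a by (simp add: words_of_length_def)
    qed
    moreover have "section_positions (map X [0..<r']) r = {start r..<start r + X r}"
      using r' by (simp add: section_positions_def take_map start_def)
    ultimately have "sectionally_homogeneous d (map X [0..<r']) (F r')"
      unfolding sectionally_homogeneous_def
      using r' ru(1,2,3) len_P'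
      by (intro exI[where x = r], intro conjI exI[of _ u] exI[of _ j] ballI) (auto simp: start_def)
    then show False using F(2)[of r'] r' by simp
  qed
  with inst show ?thesis by blast
qed

theorem theorem3p5:
  fixes d k :: nat
  assumes "d > 0" and "k > 0"
  shows "(\<exists>X. X \<in> ENSH_sequences d k) \<longleftrightarrow>
         (\<exists>c. VWI_instance d k c \<and>
              \<not> (\<exists>v. VWI_solution d c v \<and> coloring_computable d c v))"
proof
  assume "\<exists>X. X \<in> ENSH_sequences d k"
  then obtain X where "X \<in> ENSH_sequences d k" ..
  from ENSH_sequence_imp_no_computable_solution[OF assms this]
  show "\<exists>c. VWI_instance d k c \<and>
      \<not> (\<exists>v. VWI_solution d c v \<and> coloring_computable d c v)" .
next
  assume "\<exists>c. VWI_instance d k c \<and>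
      \<not> (\<exists>v. VWI_solution d c v \<and> coloring_computable d c v)"
  then obtain c where c: "VWI_instance d k c"
    "\<not> (\<exists>v. VWI_solution d c v \<and> coloring_computable d c v)"
    by (elim exE conjE)
  show "\<exists>X. X \<in> ENSH_sequences d k"
    by (rule no_computable_solution_imp_ENSH_sequence[OF assms(1) c])
qed

end
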